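(* Let $n\ge1$, $d\ge1$, let $(\Omega,\mathcal{A},\mathbb P)$ be a probability space and let $X_0,\dots,X_n,Y_0:\Omega\to\mathbb{R}^d$ be square-integrable random variables. For $i=0,\dots,n-1$ let $\mu_i(\cdot,x_0,\dots,x_i)$ be a Markov kernel from $(\mathbb{R}^d)^{i+1}$ to $\mathbb{R}^d$. Let $\epsilon\ge0$ and $K\ge0$ and assume that for every $i=0,\dots,n-1$: (i) $\displaystyle\int W_2^2\big(P_{X_{i+1}|X_0=a_0,\dots,X_i=a_i},\,\mu_i(\cdot,a_0,\dots,a_i)\big)\,\mathrm dP_{X_0,\dots,X_i}(a_0,\dots,a_i)\le\epsilon$; (ii) $W_2\big(\mu_i(\cdot,a_0,\dots,a_i),\mu_i(\cdot,b_0,\dots,b_i)\big)\le K\|(a_0,\dots,a_i)-(b_0,\dots,b_i)\|$ for all $(a_0,\dots,a_i),(b_0,\dots,b_i)\in(\mathbb{R}^d)^{i+1}$. Then $\hat P:=\mu_{n-1}(\cdot,x_0,\dots,x_{n-1})\times_{x_0,\dots,x_{n-1}}\cdots\times_{x_0}P_{Y_0}$ belongs to $\mathcal P_2(\mathbb{R}^{(n+1)d})$ and satisfies $$W_2^2(P_{X_0,\dots,X_n},\hat P)\le2\epsilon\sum_{i=0}^{n-1}(1+2K^2)^i+(1+2K^2)^n\,W_2^2(P_{X_0},P_{Y_0}).$$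
   Context: $P_Z$ denotes the law of a random variable $Z$, $P_{Z_0,\dots,Z_k}$ the joint law, and $P_{X_{i+1}|X_0=a_0,\dots,X_i=a_i}$ a regular conditional distribution (disintegration of $P_{X_0,\dots,X_{i+1}}$ with respect to its marginal $P_{X_0,\dots,X_i}$). $\mathcal P_2(\mathbb{R}^k)$ is the set of Borel probability measures on $\mathbb{R}^k$ with finite second moment; $W_2$ is the Wasserstein-2 distance with Euclidean cost, and $\|\cdot\|$ the Euclidean norm. A Markov kernel $\mu(\cdot,x)$ from $\mathbb{R}^m$ to $\mathbb{R}^k$ is a map such that $\mu(\cdot,x)$ is a Borel probability measure on $\mathbb{R}^k$ for each $x\in\mathbb{R}^m$, and $x\mapsto\mu(B,x)$ is Borel measurable for each Borel set $B\subset\mathbb{R}^k$. For a probability measure $\nu$ on $\mathbb{R}^m$, the measure $\mu(\cdot,x)\times_x\nu$ on $\mathbb{R}^m\times\mathbb{R}^k$ is defined by $\int f\,\mathrm d(\mu(\cdot,x)\times_x\nu)=\int\int f(x,y)\,\mu(\mathrm dy,x)\,\mathrm d\nu(x)$ for bounded measurable $f$. Iterating, $\hat P$ is the joint law of $(\hat X_0,\dots,\hat X_n)$ where $\hat X_0\sim P_{Y_0}$ and, given $\hat X_0=x_0,\dots,\hat X_i=x_i$, $\hat X_{i+1}\sim\mu_i(\cdot,x_0,\dots,x_i)$. *)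

theory Defs
  imports "HOL-Probability.Probability"
begin

definition ennreal_sqrt :: "ennreal \<Rightarrow> ennreal" where
  "ennreal_sqrt t = (if t = \<infinity> then \<infinity> else ennreal (sqrt (enn2real t)))"

lemma ennreal_sqrt_power2: "(ennreal_sqrt t)\<^sup>2 = t"
  by (cases t) (auto simp: ennreal_sqrt_def power2_eq_square ennreal_top_mult simp flip: ennreal_mult)

definition couplings :: "'a measure \<Rightarrow> 'b measure \<Rightarrow> ('a \<times> 'b) measure set" where
  "couplings M N =
     {\<pi>. sets \<pi> = sets (M \<Otimes>\<^sub>M N) \<and> distr \<pi> M fst = M \<and> distr \<pi> N snd = N}"

text \<open>The ground metric is a parameter, because the Euclidean metric on tuples of vectors (encoded
  below as functions on an initial segment of the naturals) is not the \<^const>\<open>dist\<close> of a type.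
  The value is \<^term>\<open>\<infinity>\<close> if no coupling has finite cost, so the definition also makes sense for
  measures without second moments.\<close>

definition wasserstein2 ::
    "('a \<Rightarrow> 'a \<Rightarrow> real) \<Rightarrow> 'a measure \<Rightarrow> 'a measure \<Rightarrow> ennreal" where
  "wasserstein2 c M N =
     ennreal_sqrt (\<Sqinter>\<pi>\<in>couplings M N. \<integral>\<^sup>+ z. ennreal ((c (fst z) (snd z))\<^sup>2) \<partial>\<pi>)"

text \<open>A point \<open>(x\<^sub>0, \<dots>, x\<^sub>i)\<close> of the \<open>(i+1)\<close>-fold power of \<open>'a\<close> is an extensional function on
  \<open>{..i}\<close>. The space is second countable, so the product sigma-algebra is the Borel one.\<close>

abbreviation path_space :: "nat \<Rightarrow> (nat \<Rightarrow> 'a::euclidean_space) measure" where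
  "path_space i \<equiv> PiM {..i} (\<lambda>_. borel)"

definition path_norm :: "nat \<Rightarrow> (nat \<Rightarrow> 'a::euclidean_space) \<Rightarrow> real" where
  "path_norm i x = L2_set (\<lambda>j. norm (x j)) {..i}"

definition path_dist ::
    "nat \<Rightarrow> (nat \<Rightarrow> 'a::euclidean_space) \<Rightarrow> (nat \<Rightarrow> 'a) \<Rightarrow> real" where
  "path_dist i x y = path_norm i (\<lambda>j. x j - y j)"

definition path_P2 :: "nat \<Rightarrow> (nat \<Rightarrow> 'a::euclidean_space) measure set" where
  "path_P2 i = {\<nu>. prob_space \<nu> \<and> sets \<nu> = sets (path_space i) \<and>
                   (\<integral>\<^sup>+ x. ennreal ((path_norm i x)\<^sup>2) \<partial>\<nu>) < \<infinity>}"

definition joint_law ::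
    "'w measure \<Rightarrow> (nat \<Rightarrow> 'w \<Rightarrow> 'a::euclidean_space) \<Rightarrow> nat \<Rightarrow> (nat \<Rightarrow> 'a) measure" where
  "joint_law \<Omega> X i = distr \<Omega> (path_space i) (\<lambda>\<omega>. \<lambda>j\<in>{..i}. X j \<omega>)"

text \<open>Membership in the measurable functions into \<^const>\<open>prob_algebra\<close> says that every value is a
  Borel probability measure and that evaluation at each Borel set is measurable.\<close>

abbreviation path_kernel ::
    "nat \<Rightarrow> ((nat \<Rightarrow> 'a::euclidean_space) \<Rightarrow> 'a measure) \<Rightarrow> bool" where
  "path_kernel i \<kappa> \<equiv> \<kappa> \<in> path_space i \<rightarrow>\<^sub>M prob_algebra borel"

definition kernel_prod :: "nat \<Rightarrow> (nat \<Rightarrow> 'a::euclidean_space) measure \<Rightarrow>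
    ((nat \<Rightarrow> 'a) \<Rightarrow> 'a measure) \<Rightarrow> (nat \<Rightarrow> 'a) measure" where
  "kernel_prod i \<nu> \<kappa> =
     \<nu> \<bind> (\<lambda>x. distr (\<kappa> x) (path_space (Suc i)) (\<lambda>y. x(Suc i := y)))"

lemma nn_integral_kernel_prod:
  fixes \<nu> :: "(nat \<Rightarrow> 'a::euclidean_space) measure"
  assumes \<nu>: "sets \<nu> = sets (path_space i)" and \<kappa>: "path_kernel i \<kappa>"
    and f[measurable]: "f \<in> borel_measurable (path_space (Suc i))"
  shows "(\<integral>\<^sup>+ z. f z \<partial>kernel_prod i \<nu> \<kappa>) = (\<integral>\<^sup>+ x. \<integral>\<^sup>+ y. f (x(Suc i := y)) \<partial>\<kappa> x \<partial>\<nu>)"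
proof -
  have upd: "(\<lambda>(x, y). x(Suc i := y)) \<in> path_space i \<Otimes>\<^sub>M borel \<rightarrow>\<^sub>M path_space (Suc i)"
    unfolding split_beta by (rule measurable_fun_upd[where J="{..i}"]) auto
  have \<kappa>': "\<kappa> \<in> path_space i \<rightarrow>\<^sub>M subprob_algebra borel"
    using \<kappa> by (rule measurable_prob_algebraD)
  have K: "(\<lambda>x. distr (\<kappa> x) (path_space (Suc i)) (\<lambda>y. x(Suc i := y)))
      \<in> \<nu> \<rightarrow>\<^sub>M subprob_algebra (path_space (Suc i))"
    unfolding measurable_cong_sets[OF \<nu> refl] by (rule measurable_distr2[OF upd \<kappa>'])
  have "(\<integral>\<^sup>+ z. f z \<partial>distr (\<kappa> x) (path_space (Suc i)) (\<lambda>y. x(Suc i := y)))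
      = (\<integral>\<^sup>+ y. f (x(Suc i := y)) \<partial>\<kappa> x)" if "x \<in> space \<nu>" for x
  proof (rule nn_integral_distr)
    have x: "x \<in> space (path_space i)"
      using that sets_eq_imp_space_eq[OF \<nu>] by simp
    have "(\<lambda>y. x(Suc i := y)) \<in> borel \<rightarrow>\<^sub>M path_space (Suc i)"
      using measurable_compose[OF measurable_Pair1'[OF x] upd] by simp
    then show "(\<lambda>y. x(Suc i := y)) \<in> \<kappa> x \<rightarrow>\<^sub>M path_space (Suc i)"
      using measurable_cong_sets[OF subprob_measurableD(2)[OF \<kappa>' x] refl] by blast
  qed simp
  then show ?thesis
    unfolding kernel_prod_def by (subst nn_integral_bind[OF f K]) (auto cong: nn_integral_cong)
qed

text \<open>A regular conditional distribution is determined only up to null sets, hence a predicate.\<close>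

definition regular_cond_dist :: "'w measure \<Rightarrow> (nat \<Rightarrow> 'w \<Rightarrow> 'a::euclidean_space) \<Rightarrow> nat \<Rightarrow>
    ((nat \<Rightarrow> 'a) \<Rightarrow> 'a measure) \<Rightarrow> bool" where
  "regular_cond_dist \<Omega> X i \<kappa> \<longleftrightarrow>
     path_kernel i \<kappa> \<and> joint_law \<Omega> X (Suc i) = kernel_prod i (joint_law \<Omega> X i) \<kappa>"

primrec iterated_prod :: "'a::euclidean_space measure \<Rightarrow> (nat \<Rightarrow> (nat \<Rightarrow> 'a) \<Rightarrow> 'a measure) \<Rightarrow>
    nat \<Rightarrow> (nat \<Rightarrow> 'a) measure" where
  "iterated_prod P \<mu> 0 = distr P (path_space 0) (\<lambda>x. \<lambda>j\<in>{..0}. x)"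
| "iterated_prod P \<mu> (Suc i) = kernel_prod i (iterated_prod P \<mu> i) (\<mu> i)"

end

theory Submission
  imports Defs
begin

text \<open>
  The proof builds a good coupling of the two processes one coordinate at a time. Suppose \<open>\<pi>\<close> couples
  the laws of \<open>(X\<^sub>0, \<dots>, X\<^sub>i)\<close> and of the first \<open>i + 1\<close> coordinates of the approximating chain. Given a
  pair \<open>(a, b)\<close> drawn from \<open>\<pi>\<close>, draw the next pair of coordinates from a nearly optimal coupling of
  \<open>\<kappa>\<^sub>i(a)\<close> and \<open>\<mu>\<^sub>i(b)\<close>. The squared path distance grows by the squared distance of the new
  coordinates, and \<open>W\<^sub>2\<^sup>2(\<kappa>\<^sub>i(a), \<mu>\<^sub>i(b)) \<le> 2 W\<^sub>2\<^sup>2(\<kappa>\<^sub>i(a), \<mu>\<^sub>i(a)) + 2 W\<^sub>2\<^sup>2(\<mu>\<^sub>i(a), \<mu>\<^sub>i(b))\<close>. Integrating, the first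
  term contributes at most \<open>2\<epsilon>\<close> and the second at most \<open>2K\<^sup>2\<close> times the cost of \<open>\<pi>\<close>. Hence the squared
  distance \<open>w\<^sub>i\<close> of the laws satisfies \<open>w\<^sub>i\<^sub>+\<^sub>1 \<le> 2\<epsilon> + (1 + 2K\<^sup>2) w\<^sub>i\<close> (\<open>wasserstein2_kernel_prod_le\<close>), and
  the recursion unrolls to the bound. The right-hand side is finite, so the approximating law
  inherits a finite second moment from the law of \<open>X\<close> (\<open>moment_le_wasserstein2\<close>).

  Three points need an argument: the near-optimal coupling has to depend measurably on \<open>(a, b)\<close>; the
  function \<open>a \<mapsto> W\<^sub>2\<^sup>2(\<kappa>\<^sub>i(a), \<mu>\<^sub>i(a))\<close> has to agree almost everywhere with a measurable one, since otherwise the integral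
  in the hypothesis is only a lower integral and would not control the cost; and \<open>W\<^sub>2\<close> has to satisfy
  the triangle inequality. All three follow from one construction. For each pair \<open>M\<close>, \<open>N\<close> of laws there is an explicit sequence
  of couplings \<open>g\<^sub>j \<cdot> (M \<Otimes> N)\<close>, with densities \<open>g\<^sub>j\<close> depending measurably on \<open>M\<close> and \<open>N\<close>, whose costs have
  infimum \<open>W\<^sub>2\<^sup>2(M, N)\<close> as soon as second moments are finite (\<open>wasserstein2_eq_INF_grid_density\<close>).
  So \<open>W\<^sub>2\<^sup>2\<close> is a countable infimum of measurable functions, a near-optimal coupling is selected by
  taking the first sufficiently good index (\<open>measurable_near_optimal_coupling\<close>), and couplings with
  densities \<open>g(x, y)\<close> and \<open>h(y, z)\<close> are glued by integrating \<open>g(x, y) h(y, z)\<close> over \<open>y\<close>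
  (\<open>glue_coupling_densities\<close>).

  To obtain \<open>g\<^sub>j\<close>, cut the space into countably many cells of small diameter. Within each product of
  two cells a coupling may be replaced by a multiple of the product measure, at a cost controlled by
  the diameter. This gives a density that is constant on products of cells. Rounding down finitely many
  of its values to dyadic rationals and discarding the others leaves countably many step functions; the
  mass they lose is restored by the product of the residual marginals, and finiteness of the
  second moments makes the cost of that correction vanish in the limit.
\<close>

section \<open>Couplings and square transport costs\<close>

lemma wasserstein2_le_coupling:
  assumes "\<pi> \<in> couplings M N"
  shows "(wasserstein2 c M N)\<^sup>2 \<le> (\<integral>\<^sup>+ z. ennreal ((c (fst z) (snd z))\<^sup>2) \<partial>\<pi>)"
  unfolding wasserstein2_def ennreal_sqrt_power2 using assms by (rule INF_lower)

lemma nn_integral_couplings: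
  assumes \<pi>: "\<pi> \<in> couplings M N"
  shows "u \<in> borel_measurable M \<Longrightarrow> (\<integral>\<^sup>+ z. u (fst z) \<partial>\<pi>) = (\<integral>\<^sup>+ x. u x \<partial>M)"
    and "v \<in> borel_measurable N \<Longrightarrow> (\<integral>\<^sup>+ z. v (snd z) \<partial>\<pi>) = (\<integral>\<^sup>+ y. v y \<partial>N)"
proof -
  have [measurable_cong]: "sets \<pi> = sets (M \<Otimes>\<^sub>M N)" and 1: "distr \<pi> M fst = M" "distr \<pi> N snd = N"
    using \<pi> by (auto simp: couplings_def)
  show "(\<integral>\<^sup>+ z. u (fst z) \<partial>\<pi>) = (\<integral>\<^sup>+ x. u x \<partial>M)" if [measurable]: "u \<in> borel_measurable M"
    using nn_integral_distr[of fst \<pi> M u] 1 by simp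
  show "(\<integral>\<^sup>+ z. v (snd z) \<partial>\<pi>) = (\<integral>\<^sup>+ y. v y \<partial>N)" if [measurable]: "v \<in> borel_measurable N"
    using nn_integral_distr[of snd \<pi> N v] 1 by simp
qed

lemma couplings_prob_space:
  assumes "\<pi> \<in> couplings M N" "prob_space M"
  shows "prob_space \<pi>"
proof (rule prob_space_distrD)
  show "fst \<in> \<pi> \<rightarrow>\<^sub>M M" using assms by (auto simp: couplings_def cong: measurable_cong_sets)
  show "prob_space (distr \<pi> M fst)" using assms by (simp add: couplings_def)
qed

lemma flip_coupling:
  assumes "\<pi> \<in> couplings M N"
  shows "distr \<pi> (N \<Otimes>\<^sub>M M) (\<lambda>z. (snd z, fst z)) \<in> couplings N M"
proof -
  have [measurable_cong]: "sets \<pi> = sets (M \<Otimes>\<^sub>M N)" and 1: "distr \<pi> M fst = M" "distr \<pi> N snd = N"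
    using assms by (auto simp: couplings_def)
  show ?thesis using 1 by (simp add: couplings_def distr_distr comp_def)
qed

lemma distr_in_couplings:
  assumes \<pi>: "\<pi> \<in> couplings M N" and f[measurable]: "f \<in> M \<rightarrow>\<^sub>M M'" and g[measurable]: "g \<in> N \<rightarrow>\<^sub>M N'"
  shows "distr \<pi> (M' \<Otimes>\<^sub>M N') (\<lambda>z. (f (fst z), g (snd z))) \<in> couplings (distr M M' f) (distr N N' g)"
proof -
  have [measurable_cong]: "sets \<pi> = sets (M \<Otimes>\<^sub>M N)" and 1: "distr \<pi> M fst = M" "distr \<pi> N snd = N"
    using \<pi> by (auto simp: couplings_def)
  have "distr (distr \<pi> M fst) M' f = distr \<pi> M' (\<lambda>z. f (fst z))"
    "distr (distr \<pi> N snd) N' g = distr \<pi> N' (\<lambda>z. g (snd z))"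
    by (subst distr_distr; simp add: comp_def)+
  then have eq: "distr \<pi> M' (\<lambda>z. f (fst z)) = distr M M' f" "distr \<pi> N' (\<lambda>z. g (snd z)) = distr N N' g"
    unfolding 1 by simp_all
  have "distr (distr \<pi> (M' \<Otimes>\<^sub>M N') (\<lambda>z. (f (fst z), g (snd z)))) (distr M M' f) fst = distr \<pi> M' (\<lambda>z. f (fst z))"
    "distr (distr \<pi> (M' \<Otimes>\<^sub>M N') (\<lambda>z. (f (fst z), g (snd z)))) (distr N N' g) snd = distr \<pi> N' (\<lambda>z. g (snd z))"
    by (subst distr_distr; simp add: comp_def cong: distr_cong)+
  then show ?thesis
    by (simp add: couplings_def eq cong: sets_pair_measure_cong)
qed

lemma distr_Pair_in_couplings:
  assumes [measurable]: "X \<in> \<Omega> \<rightarrow>\<^sub>M M" "Y \<in> \<Omega> \<rightarrow>\<^sub>M N"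
  shows "distr \<Omega> (M \<Otimes>\<^sub>M N) (\<lambda>\<omega>. (X \<omega>, Y \<omega>)) \<in> couplings (distr \<Omega> M X) (distr \<Omega> N Y)"
proof -
  have "distr (distr \<Omega> (M \<Otimes>\<^sub>M N) (\<lambda>\<omega>. (X \<omega>, Y \<omega>))) (distr \<Omega> M X) fst = distr \<Omega> M X"
    "distr (distr \<Omega> (M \<Otimes>\<^sub>M N) (\<lambda>\<omega>. (X \<omega>, Y \<omega>))) (distr \<Omega> N Y) snd = distr \<Omega> N Y"
    by (subst distr_distr; simp add: comp_def cong: distr_cong)+
  then show ?thesis by (simp add: couplings_def cong: sets_pair_measure_cong)
qed

lemma INF_ennreal_cmult:
  fixes f :: "'i \<Rightarrow> ennreal"
  assumes "c < top" "A \<noteq> {}"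
  shows "(INF i\<in>A. c * f i) = c * (INF i\<in>A. f i)"
proof -
  have "continuous (at_right (Inf (f ` A))) (\<lambda>x. c * x)"
    unfolding continuous_within by (intro ennreal_tendsto_cmult[OF assms(1)] tendsto_ident_at)
  then show ?thesis
    using continuous_at_Inf_mono[of "\<lambda>x. c * x" "f ` A"] assms(2)
    by (simp add: image_comp mono_def mult_left_mono)
qed

text \<open>Passing an affine bound from all couplings to their infimum. If there is no coupling, then
  \<open>W\<^sub>2 = \<infinity>\<close>, and \<open>0 < k\<close> keeps the right-hand side infinite.\<close>

lemma le_add_cmult_wasserstein2:
  assumes le: "\<And>\<pi>. \<pi> \<in> couplings M N \<Longrightarrow> x \<le> e + k * (\<integral>\<^sup>+ z. ennreal ((c (fst z) (snd z))\<^sup>2) \<partial>\<pi>)"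
    and k: "0 < k" "k < top"
  shows "x \<le> e + k * (wasserstein2 c M N)\<^sup>2"
proof (cases "couplings M N = {} \<or> e = \<infinity>")
  case True
  then show ?thesis
    using k by (auto simp: wasserstein2_def ennreal_sqrt_power2 ennreal_mult_top)
next
  case False
  let ?C = "\<lambda>\<pi>. \<integral>\<^sup>+ z. ennreal ((c (fst z) (snd z))\<^sup>2) \<partial>\<pi>"
  have "x - e \<le> (INF \<pi>\<in>couplings M N. k * ?C \<pi>)"
    using le False by (intro INF_greatest) (auto simp: ennreal_minus_le_iff)
  also have "\<dots> = k * (wasserstein2 c M N)\<^sup>2"
    unfolding wasserstein2_def ennreal_sqrt_power2 using False k by (intro INF_ennreal_cmult) auto
  finally show ?thesis using False by (simp add: ennreal_minus_le_iff)
qed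

lemma square_dist_triangle:
  "ennreal ((dist x z)\<^sup>2) \<le> 2 * ennreal ((dist x y)\<^sup>2) + 2 * ennreal ((dist y z)\<^sup>2)"
proof -
  have "(dist x z)\<^sup>2 \<le> (dist x y + dist y z)\<^sup>2"
    by (intro power_mono dist_triangle) auto
  also have "\<dots> \<le> 2 * (dist x y)\<^sup>2 + 2 * (dist y z)\<^sup>2"
    using sum_squares_ge_zero[of "dist x y - dist y z" 0] by (simp add: power2_eq_square algebra_simps)
  finally show ?thesis
    by (simp add: ennreal_leI ennreal_mult[symmetric] ennreal_plus[symmetric] del: ennreal_plus flip: ennreal_numeral)
qed

lemma square_dist_le_square_norms:
  fixes x y :: "'a::real_normed_vector"
  shows "ennreal ((dist x y)\<^sup>2) \<le> 2 * ennreal ((norm x)\<^sup>2) + 2 * ennreal ((norm y)\<^sup>2)"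
  using square_dist_triangle[of x y 0] by simp

definition second_moment :: "'a::real_normed_vector measure \<Rightarrow> ennreal" where
  "second_moment M = (\<integral>\<^sup>+ x. ennreal ((norm x)\<^sup>2) \<partial>M)"

text \<open>The route by which integrability moves from one law to another at finite distance; it serves both
  for the transition kernels and for the laws of whole paths, hence the abstract \<open>u\<close>, \<open>v\<close> and \<open>c\<close>.\<close>

lemma moment_le_wasserstein2:
  assumes u[measurable]: "u \<in> borel_measurable M" and v[measurable]: "v \<in> borel_measurable N"
    and c[measurable]: "(\<lambda>z. ennreal ((c (fst z) (snd z))\<^sup>2)) \<in> borel_measurable (M \<Otimes>\<^sub>M N)"
    and le: "\<And>x y. v y \<le> 2 * u x + 2 * ennreal ((c x y)\<^sup>2)"
  shows "(\<integral>\<^sup>+ y. v y \<partial>N) \<le> 2 * (\<integral>\<^sup>+ x. u x \<partial>M) + 2 * (wasserstein2 c M N)\<^sup>2"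
proof (rule le_add_cmult_wasserstein2)
  fix \<pi> assume \<pi>: "\<pi> \<in> couplings M N"
  have sets[measurable_cong]: "sets \<pi> = sets (M \<Otimes>\<^sub>M N)" using \<pi> by (simp add: couplings_def)
  define C where "C z = ennreal ((c (fst z) (snd z))\<^sup>2)" for z
  have [measurable]: "C \<in> borel_measurable \<pi>"
    using c unfolding C_def by (simp only: measurable_cong_sets[OF sets refl])
  have "(\<integral>\<^sup>+ y. v y \<partial>N) = (\<integral>\<^sup>+ z. v (snd z) \<partial>\<pi>)"
    by (rule nn_integral_couplings(2)[OF \<pi> v, symmetric])
  also have "\<dots> \<le> (\<integral>\<^sup>+ z. 2 * u (fst z) + 2 * C z \<partial>\<pi>)"
    unfolding C_def by (intro nn_integral_mono le)
  also have "\<dots> = 2 * (\<integral>\<^sup>+ z. u (fst z) \<partial>\<pi>) + 2 * (\<integral>\<^sup>+ z. C z \<partial>\<pi>)"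
    by (simp add: nn_integral_add nn_integral_cmult)
  finally show "(\<integral>\<^sup>+ y. v y \<partial>N) \<le> 2 * (\<integral>\<^sup>+ x. u x \<partial>M) + 2 * (\<integral>\<^sup>+ z. ennreal ((c (fst z) (snd z))\<^sup>2) \<partial>\<pi>)"
    by (simp add: nn_integral_couplings(1)[OF \<pi> u] C_def)
qed (auto simp: less_top[symmetric])

lemma second_moment_le_wasserstein2:
  fixes M N :: "'a::{real_normed_vector, second_countable_topology} measure"
  assumes M[measurable_cong]: "sets M = sets borel" and N[measurable_cong]: "sets N = sets borel"
  shows "second_moment N \<le> 2 * second_moment M + 2 * (wasserstein2 dist M N)\<^sup>2"
  unfolding second_moment_def
proof (rule moment_le_wasserstein2)
  fix x y :: 'a
  show "ennreal ((norm y)\<^sup>2) \<le> 2 * ennreal ((norm x)\<^sup>2) + 2 * ennreal ((dist x y)\<^sup>2)"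
    using square_dist_triangle[of 0 y x] by simp
qed measurable

text \<open>Applied to the identification of a point with the path of length one through it.\<close>

lemma wasserstein2_distr_le:
  assumes f[measurable]: "f \<in> M \<rightarrow>\<^sub>M M'" "f \<in> N \<rightarrow>\<^sub>M M'"
    and c'[measurable]: "(\<lambda>z. ennreal ((c' (fst z) (snd z))\<^sup>2)) \<in> borel_measurable (M' \<Otimes>\<^sub>M M')"
    and isometry: "\<And>x y. (c' (f x) (f y))\<^sup>2 = (c x y)\<^sup>2"
  shows "(wasserstein2 c' (distr M M' f) (distr N M' f))\<^sup>2 \<le> (wasserstein2 c M N)\<^sup>2"
proof -
  have "(wasserstein2 c' (distr M M' f) (distr N M' f))\<^sup>2 \<le> (\<integral>\<^sup>+ z. ennreal ((c (fst z) (snd z))\<^sup>2) \<partial>\<pi>)"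
    if \<pi>: "\<pi> \<in> couplings M N" for \<pi>
  proof -
    have [measurable_cong]: "sets \<pi> = sets (M \<Otimes>\<^sub>M N)" using \<pi> by (auto simp: couplings_def)
    have F: "(\<lambda>z. (f (fst z), f (snd z))) \<in> \<pi> \<rightarrow>\<^sub>M M' \<Otimes>\<^sub>M M'" by measurable
    have "(wasserstein2 c' (distr M M' f) (distr N M' f))\<^sup>2
        \<le> (\<integral>\<^sup>+ z. ennreal ((c' (fst z) (snd z))\<^sup>2) \<partial>distr \<pi> (M' \<Otimes>\<^sub>M M') (\<lambda>z. (f (fst z), f (snd z))))"
      by (intro wasserstein2_le_coupling distr_in_couplings \<pi> f)
    also have "\<dots> = (\<integral>\<^sup>+ z. ennreal ((c (fst z) (snd z))\<^sup>2) \<partial>\<pi>)"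
      using c' by (subst nn_integral_distr[OF F]) (simp_all add: isometry)
    finally show ?thesis .
  qed
  then show ?thesis
    unfolding wasserstein2_def[of c M N] ennreal_sqrt_power2 by (rule INF_greatest)
qed

lemma wasserstein2_square_integrable:
  fixes X Y :: "'w \<Rightarrow> 'a::{real_normed_vector, second_countable_topology}"
  assumes [measurable]: "X \<in> borel_measurable \<Omega>" "Y \<in> borel_measurable \<Omega>"
    and fin: "(\<integral>\<^sup>+ \<omega>. ennreal ((norm (X \<omega>))\<^sup>2) \<partial>\<Omega>) < \<infinity>" "(\<integral>\<^sup>+ \<omega>. ennreal ((norm (Y \<omega>))\<^sup>2) \<partial>\<Omega>) < \<infinity>"
  shows "(wasserstein2 dist (distr \<Omega> borel X) (distr \<Omega> borel Y))\<^sup>2 < \<infinity>"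
proof -
  have "(wasserstein2 dist (distr \<Omega> borel X) (distr \<Omega> borel Y))\<^sup>2
      \<le> (\<integral>\<^sup>+ z. ennreal ((dist (fst z) (snd z))\<^sup>2) \<partial>distr \<Omega> (borel \<Otimes>\<^sub>M borel) (\<lambda>\<omega>. (X \<omega>, Y \<omega>)))"
    by (intro wasserstein2_le_coupling distr_Pair_in_couplings) measurable
  also have "\<dots> = (\<integral>\<^sup>+ \<omega>. ennreal ((dist (X \<omega>) (Y \<omega>))\<^sup>2) \<partial>\<Omega>)"
    by (subst nn_integral_distr) simp_all
  also have "\<dots> \<le> (\<integral>\<^sup>+ \<omega>. 2 * ennreal ((norm (X \<omega>))\<^sup>2) + 2 * ennreal ((norm (Y \<omega>))\<^sup>2) \<partial>\<Omega>)"
    by (intro nn_integral_mono square_dist_le_square_norms)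
  also have "\<dots> = 2 * (\<integral>\<^sup>+ \<omega>. ennreal ((norm (X \<omega>))\<^sup>2) \<partial>\<Omega>) + 2 * (\<integral>\<^sup>+ \<omega>. ennreal ((norm (Y \<omega>))\<^sup>2) \<partial>\<Omega>)"
    by (simp add: nn_integral_add nn_integral_cmult)
  also have "\<dots> < \<infinity>" using fin by (simp add: ennreal_mult_less_top)
  finally show ?thesis .
qed

section \<open>Couplings with a density\<close>

definition coupling_density :: "'a measure \<Rightarrow> 'b measure \<Rightarrow> ('a \<Rightarrow> 'b \<Rightarrow> ennreal) \<Rightarrow> bool" where
  "coupling_density M N g \<longleftrightarrow> case_prod g \<in> borel_measurable (M \<Otimes>\<^sub>M N) \<and>
     (AE x in M. (\<integral>\<^sup>+ y. g x y \<partial>N) = 1) \<and> (AE y in N. (\<integral>\<^sup>+ x. g x y \<partial>M) = 1)"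

text \<open>The marginal conditions are required only almost everywhere, because the densities constructed
  below may fail them on null sets.\<close>

lemma (in pair_sigma_finite) density_in_couplings:
  assumes "coupling_density M1 M2 g"
  shows "density (M1 \<Otimes>\<^sub>M M2) (case_prod g) \<in> couplings M1 M2"
proof -
  have g[measurable]: "case_prod g \<in> borel_measurable (M1 \<Otimes>\<^sub>M M2)"
    and 1: "AE x in M1. (\<integral>\<^sup>+ y. g x y \<partial>M2) = 1" and 2: "AE y in M2. (\<integral>\<^sup>+ x. g x y \<partial>M1) = 1"
    using assms by (auto simp: coupling_density_def)
  have "distr (density (M1 \<Otimes>\<^sub>M M2) (case_prod g)) M1 fst = M1"
  proof (rule measure_eqI)
    fix A assume "A \<in> sets (distr (density (M1 \<Otimes>\<^sub>M M2) (case_prod g)) M1 fst)"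
    then have A[measurable]: "A \<in> sets M1" by simp
    have "emeasure (distr (density (M1 \<Otimes>\<^sub>M M2) (case_prod g)) M1 fst) A
        = (\<integral>\<^sup>+ z. case_prod g z * indicator A (fst z) \<partial>(M1 \<Otimes>\<^sub>M M2))"
      by (subst nn_integral_indicator[symmetric], simp, subst nn_integral_distr, simp, simp,
          subst nn_integral_density) auto
    also have "\<dots> = (\<integral>\<^sup>+ x. (\<integral>\<^sup>+ y. g x y * indicator A x \<partial>M2) \<partial>M1)"
      by (subst M2.nn_integral_fst[symmetric]) auto
    also have "\<dots> = (\<integral>\<^sup>+ x. (\<integral>\<^sup>+ y. g x y \<partial>M2) * indicator A x \<partial>M1)"
      by (intro nn_integral_cong nn_integral_multc) simp
    also have "\<dots> = (\<integral>\<^sup>+ x. indicator A x \<partial>M1)"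
      using 1 by (intro nn_integral_cong_AE) auto
    finally show "emeasure (distr (density (M1 \<Otimes>\<^sub>M M2) (case_prod g)) M1 fst) A = emeasure M1 A"
      by simp
  qed simp
  moreover have "distr (density (M1 \<Otimes>\<^sub>M M2) (case_prod g)) M2 snd = M2"
  proof (rule measure_eqI)
    fix A assume "A \<in> sets (distr (density (M1 \<Otimes>\<^sub>M M2) (case_prod g)) M2 snd)"
    then have A[measurable]: "A \<in> sets M2" by simp
    have "emeasure (distr (density (M1 \<Otimes>\<^sub>M M2) (case_prod g)) M2 snd) A
        = (\<integral>\<^sup>+ z. case_prod g z * indicator A (snd z) \<partial>(M1 \<Otimes>\<^sub>M M2))"
      by (subst nn_integral_indicator[symmetric], simp, subst nn_integral_distr, simp, simp,
          subst nn_integral_density) auto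
    also have "\<dots> = (\<integral>\<^sup>+ y. (\<integral>\<^sup>+ x. g x y * indicator A y \<partial>M1) \<partial>M2)"
      by (subst nn_integral_snd[symmetric]) auto
    also have "\<dots> = (\<integral>\<^sup>+ y. (\<integral>\<^sup>+ x. g x y \<partial>M1) * indicator A y \<partial>M2)"
      by (intro nn_integral_cong nn_integral_multc) simp
    also have "\<dots> = (\<integral>\<^sup>+ y. indicator A y \<partial>M2)"
      using 2 by (intro nn_integral_cong_AE) auto
    finally show "emeasure (distr (density (M1 \<Otimes>\<^sub>M M2) (case_prod g)) M2 snd) A = emeasure M2 A"
      by simp
  qed simp
  ultimately show ?thesis by (simp add: couplings_def)
qed

definition square_cost :: "'a::metric_space measure \<Rightarrow> 'a measure \<Rightarrow> ('a \<Rightarrow> 'a \<Rightarrow> ennreal) \<Rightarrow> ennreal" where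
  "square_cost M N g = (\<integral>\<^sup>+ x. \<integral>\<^sup>+ y. ennreal ((dist x y)\<^sup>2) * g x y \<partial>N \<partial>M)"

locale borel_pair = pair_prob_space M1 M2
  for M1 M2 :: "'a::{real_normed_vector, second_countable_topology} measure" +
  assumes sets_M1[measurable_cong, simp]: "sets M1 = sets borel"
    and sets_M2[measurable_cong, simp]: "sets M2 = sets borel"

lemma borel_pairI:
  "M \<in> space (prob_algebra borel) \<Longrightarrow> N \<in> space (prob_algebra borel) \<Longrightarrow> borel_pair M N"
  by (simp add: space_prob_algebra borel_pair_def borel_pair_axioms_def pair_prob_space_def
      pair_sigma_finite_def prob_space_imp_sigma_finite)

context borel_pair
begin

lemma nn_integral_density_dist:
  assumes g: "coupling_density M1 M2 g"
  shows "(\<integral>\<^sup>+ z. ennreal ((dist (fst z) (snd z))\<^sup>2) \<partial>density (M1 \<Otimes>\<^sub>M M2) (case_prod g))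
    = square_cost M1 M2 g"
proof -
  have [measurable]: "case_prod g \<in> borel_measurable (M1 \<Otimes>\<^sub>M M2)"
    using g by (auto simp: coupling_density_def)
  have "(\<integral>\<^sup>+ z. ennreal ((dist (fst z) (snd z))\<^sup>2) \<partial>density (M1 \<Otimes>\<^sub>M M2) (case_prod g))
      = (\<integral>\<^sup>+ z. case_prod g z * ennreal ((dist (fst z) (snd z))\<^sup>2) \<partial>(M1 \<Otimes>\<^sub>M M2))"
    by (intro nn_integral_density) auto
  also have "\<dots> = square_cost M1 M2 g"
    unfolding square_cost_def by (subst M2.nn_integral_fst[symmetric]) (auto simp: mult.commute)
  finally show ?thesis .
qed

lemma wasserstein2_le_density:
  assumes "coupling_density M1 M2 g"
  shows "(wasserstein2 dist M1 M2)\<^sup>2 \<le> square_cost M1 M2 g"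
  using wasserstein2_le_coupling[OF density_in_couplings[OF assms], of dist] nn_integral_density_dist[OF assms]
  by simp

end

text \<open>If the marginals of \<open>f \<cdot> (M \<Otimes> N)\<close> are at most \<open>M\<close> and \<open>N\<close>, their deficits have the same total mass, and
  the normalised product of the deficits repairs both marginals at once. When there is nothing to
  repair, the quotient is \<open>0 / 0\<close>, which is \<open>0\<close> in the extended nonnegative reals.\<close>

definition residual_completion ::
    "'a measure \<Rightarrow> 'b measure \<Rightarrow> ('a \<Rightarrow> 'b \<Rightarrow> ennreal) \<Rightarrow> 'a \<Rightarrow> 'b \<Rightarrow> ennreal" where
  "residual_completion M N f x y = f x y +
     (1 - (\<integral>\<^sup>+ y'. f x y' \<partial>N)) * (1 - (\<integral>\<^sup>+ x'. f x' y \<partial>M)) / (1 - (\<integral>\<^sup>+ x'. \<integral>\<^sup>+ y'. f x' y' \<partial>N \<partial>M))"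

lemma (in prob_space) nn_integral_one_minus:
  assumes [measurable]: "f \<in> borel_measurable M" and "\<And>x. f x \<le> 1"
  shows "(\<integral>\<^sup>+ x. (1 - f x) \<partial>M) = 1 - (\<integral>\<^sup>+ x. f x \<partial>M)"
proof -
  have "(\<integral>\<^sup>+ x. f x \<partial>M) \<le> (\<integral>\<^sup>+ x. 1 \<partial>M)" using assms(2) by (intro nn_integral_mono) auto
  then have "(\<integral>\<^sup>+ x. f x \<partial>M) \<noteq> \<infinity>" by (auto simp: emeasure_space_1 top_unique)
  then show ?thesis using assms(2)
    by (subst nn_integral_diff) (auto simp: emeasure_space_1)
qed

locale subcoupling_density = pair_prob_space M1 M2
  for M1 :: "'a measure" and M2 :: "'b measure" +
  fixes f :: "'a \<Rightarrow> 'b \<Rightarrow> ennreal"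
  assumes f[measurable]: "case_prod f \<in> borel_measurable (M1 \<Otimes>\<^sub>M M2)"
    and marginal1_le: "\<And>x. (\<integral>\<^sup>+ y. f x y \<partial>M2) \<le> 1"
    and marginal2_le: "\<And>y. (\<integral>\<^sup>+ x. f x y \<partial>M1) \<le> 1"
begin

definition residual1 where "residual1 x = 1 - (\<integral>\<^sup>+ y. f x y \<partial>M2)"
definition residual2 where "residual2 y = 1 - (\<integral>\<^sup>+ x. f x y \<partial>M1)"
definition residual_mass where "residual_mass = 1 - (\<integral>\<^sup>+ x. \<integral>\<^sup>+ y. f x y \<partial>M2 \<partial>M1)"

lemma residual_completion_eq:
  "residual_completion M1 M2 f x y = f x y + residual1 x * residual2 y / residual_mass"
  by (simp add: residual_completion_def residual1_def residual2_def residual_mass_def)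

lemma measurable_residual1[measurable]: "residual1 \<in> borel_measurable M1"
  unfolding residual1_def by measurable

lemma measurable_residual2[measurable]: "residual2 \<in> borel_measurable M2"
  unfolding residual2_def by measurable

lemma measurable_residual_completion:
  "case_prod (residual_completion M1 M2 f) \<in> borel_measurable (M1 \<Otimes>\<^sub>M M2)"
  unfolding residual_completion_eq[abs_def] by measurable

lemma nn_integral_residual1: "(\<integral>\<^sup>+ x. residual1 x \<partial>M1) = residual_mass"
  unfolding residual1_def residual_mass_def
  using marginal1_le by (subst M1.nn_integral_one_minus) auto

lemma nn_integral_residual2: "(\<integral>\<^sup>+ y. residual2 y \<partial>M2) = residual_mass"
  unfolding residual2_def residual_mass_def
  using marginal2_le by (subst M2.nn_integral_one_minus) (auto simp: Fubini')

lemma residual_mass_divide: "residual_mass \<noteq> 0 \<Longrightarrow> residual_mass / residual_mass = 1"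
  by (rule ennreal_divide_self) (auto simp: residual_mass_def less_top[symmetric])

text \<open>The cancellation can fail only where the residual mass is \<open>0\<close>, and there \<open>residual1\<close> integrates to \<open>0\<close>.\<close>

lemma AE_residual1: "AE x in M1. residual1 x * residual_mass / residual_mass = residual1 x"
proof (cases "residual_mass = 0")
  case True
  then show ?thesis
    using nn_integral_0_iff_AE[of residual1 M1] nn_integral_residual1 by auto
next
  case False
  then show ?thesis
    by (simp add: ennreal_times_divide[symmetric] residual_mass_divide)
qed

lemma marginal1_residual_completion:
  "AE x in M1. (\<integral>\<^sup>+ y. residual_completion M1 M2 f x y \<partial>M2) = 1"
proof -
  have "AE x in M1. x \<in> space M1" by simp
  with AE_residual1 show ?thesis
  proof eventually_elim
    case (elim x)
    have "(\<integral>\<^sup>+ y. residual_completion M1 M2 f x y \<partial>M2)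
        = (\<integral>\<^sup>+ y. f x y \<partial>M2) + residual1 x * residual_mass / residual_mass"
      using elim unfolding residual_completion_eq
      by (subst nn_integral_add)
        (auto simp: nn_integral_divide nn_integral_cmult nn_integral_residual2)
    with elim marginal1_le[of x] show ?case
      by (simp add: residual1_def)
  qed
qed

lemma nn_integral_residual_product:
  assumes [measurable]: "u \<in> borel_measurable M1"
  shows "(\<integral>\<^sup>+ x. \<integral>\<^sup>+ y. u x * (residual1 x * residual2 y / residual_mass) \<partial>M2 \<partial>M1)
      = (\<integral>\<^sup>+ x. u x * residual1 x \<partial>M1)"
proof (rule nn_integral_cong_AE)
  show "AE x in M1. (\<integral>\<^sup>+ y. u x * (residual1 x * residual2 y / residual_mass) \<partial>M2)
      = u x * residual1 x"
    using AE_residual1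
  proof eventually_elim
    case (elim x)
    then show ?case
      by (simp add: nn_integral_divide nn_integral_cmult nn_integral_residual2)
  qed
qed

end

text \<open>The construction is symmetric in the two marginals, so that each one-sided fact has its mirror image.\<close>

sublocale subcoupling_density \<subseteq> flip: subcoupling_density M2 M1 "\<lambda>y x. f x y"
  rewrites "subcoupling_density.residual1 M1 (\<lambda>y x. f x y) = residual2"
    and "subcoupling_density.residual2 M2 (\<lambda>y x. f x y) = residual1"
    and "subcoupling_density.residual_mass M2 M1 (\<lambda>y x. f x y) = residual_mass"
proof -
  show *: "subcoupling_density M2 M1 (\<lambda>y x. f x y)"
    using marginal1_le marginal2_le
    by unfold_locales (simp_all add: measurable_split_conv)
  show "subcoupling_density.residual1 M1 (\<lambda>y x. f x y) = residual2"
    unfolding subcoupling_density.residual1_def[OF *] residual2_def ..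
  show "subcoupling_density.residual2 M2 (\<lambda>y x. f x y) = residual1"
    unfolding subcoupling_density.residual2_def[OF *] residual1_def ..
  show "subcoupling_density.residual_mass M2 M1 (\<lambda>y x. f x y) = residual_mass"
    unfolding subcoupling_density.residual_mass_def[OF *] residual_mass_def by (simp add: Fubini')
qed

context subcoupling_density
begin

lemma coupling_density_residual_completion: "coupling_density M1 M2 (residual_completion M1 M2 f)"
proof -
  have "residual_completion M2 M1 (\<lambda>y x. f x y) y x = residual_completion M1 M2 f x y" for x y
    by (simp add: residual_completion_eq flip.residual_completion_eq mult.commute)
  with flip.marginal1_residual_completion marginal1_residual_completion
    measurable_residual_completion
  show ?thesis by (simp add: coupling_density_def)
qed

lemma nn_integral_residual_product_sum:
  assumes u[measurable]: "u \<in> borel_measurable M1" and v[measurable]: "v \<in> borel_measurable M2"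
  shows "(\<integral>\<^sup>+ x. \<integral>\<^sup>+ y. (u x + v y) * (residual1 x * residual2 y / residual_mass) \<partial>M2 \<partial>M1)
      = (\<integral>\<^sup>+ x. u x * residual1 x \<partial>M1) + (\<integral>\<^sup>+ y. v y * residual2 y \<partial>M2)"
proof -
  have "(\<integral>\<^sup>+ x. \<integral>\<^sup>+ y. v y * (residual1 x * residual2 y / residual_mass) \<partial>M2 \<partial>M1)
      = (\<integral>\<^sup>+ y. \<integral>\<^sup>+ x. v y * (residual1 x * residual2 y / residual_mass) \<partial>M1 \<partial>M2)"
    by (rule Fubini'[symmetric]) measurable
  also have "\<dots> = (\<integral>\<^sup>+ y. v y * residual2 y \<partial>M2)"
    using flip.nn_integral_residual_product[OF v] by (simp add: mult.commute)
  finally show ?thesis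
    using nn_integral_residual_product[OF u]
    by (simp add: distrib_right nn_integral_add)
qed

end

text \<open>The residual product spreads its mass without regard to distance. Bounding the squared distance by
  the squared norms makes its cost separate into two integrals that are small once the deficits are.\<close>

lemma (in borel_pair) square_cost_residual_completion_le:
  assumes "subcoupling_density M1 M2 f"
  shows "square_cost M1 M2 (residual_completion M1 M2 f)
      \<le> square_cost M1 M2 f
        + 2 * (\<integral>\<^sup>+ x. ennreal ((norm x)\<^sup>2) * (1 - (\<integral>\<^sup>+ y. f x y \<partial>M2)) \<partial>M1)
        + 2 * (\<integral>\<^sup>+ y. ennreal ((norm y)\<^sup>2) * (1 - (\<integral>\<^sup>+ x. f x y \<partial>M1)) \<partial>M2)"
proof -
  interpret subcoupling_density M1 M2 f by fact
  let ?g = "\<lambda>x y. residual1 x * residual2 y / residual_mass"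
  have "square_cost M1 M2 (residual_completion M1 M2 f)
      \<le> (\<integral>\<^sup>+ x. \<integral>\<^sup>+ y. ennreal ((dist x y)\<^sup>2) * f x y
          + (2 * ennreal ((norm x)\<^sup>2) + 2 * ennreal ((norm y)\<^sup>2)) * ?g x y \<partial>M2 \<partial>M1)"
    unfolding square_cost_def residual_completion_eq distrib_left
    by (intro nn_integral_mono add_left_mono mult_right_mono square_dist_le_square_norms) auto
  also have "\<dots> = square_cost M1 M2 f
      + (\<integral>\<^sup>+ x. \<integral>\<^sup>+ y. (2 * ennreal ((norm x)\<^sup>2) + 2 * ennreal ((norm y)\<^sup>2)) * ?g x y \<partial>M2 \<partial>M1)"
    unfolding square_cost_def
    by (subst nn_integral_add[symmetric]) (auto intro!: nn_integral_cong nn_integral_add)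
  also have "(\<integral>\<^sup>+ x. \<integral>\<^sup>+ y. (2 * ennreal ((norm x)\<^sup>2) + 2 * ennreal ((norm y)\<^sup>2)) * ?g x y \<partial>M2 \<partial>M1)
      = 2 * (\<integral>\<^sup>+ x. ennreal ((norm x)\<^sup>2) * residual1 x \<partial>M1)
        + 2 * (\<integral>\<^sup>+ y. ennreal ((norm y)\<^sup>2) * residual2 y \<partial>M2)"
    by (subst nn_integral_residual_product_sum) (auto simp: mult.assoc nn_integral_cmult)
  finally show ?thesis by (simp add: residual1_def residual2_def add.assoc)
qed

section \<open>Discretised couplings\<close>

lemma ennreal_mult_right_le: "(b::ennreal) \<le> 1 \<Longrightarrow> a * b \<le> a"
  using mult_left_mono[of b 1 a] by simp

lemma nn_integral_countable_valued:
  fixes q :: "'a \<Rightarrow> 'c::countable" and h :: "'c \<Rightarrow> ennreal"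
  assumes [measurable]: "q \<in> M \<rightarrow>\<^sub>M count_space UNIV"
  shows "(\<integral>\<^sup>+ x. h (q x) \<partial>M) = (\<integral>\<^sup>+ c. h c * emeasure M (q -` {c} \<inter> space M) \<partial>count_space UNIV)"
proof -
  have "(\<integral>\<^sup>+ x. h (q x) \<partial>M) = (\<integral>\<^sup>+ x. \<integral>\<^sup>+ c. h c * indicator (q -` {c} \<inter> space M) x \<partial>count_space UNIV \<partial>M)"
  proof (rule nn_integral_cong)
    fix x assume "x \<in> space M"
    then have "(\<integral>\<^sup>+ c. h c * indicator (q -` {c} \<inter> space M) x \<partial>count_space UNIV)
        = (\<integral>\<^sup>+ c. h (q x) * indicator {q x} c \<partial>count_space UNIV)"
      by (intro nn_integral_cong) (auto split: split_indicator)
    also have "\<dots> = h (q x)" by (subst nn_integral_cmult_indicator) auto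
    finally show "h (q x) = (\<integral>\<^sup>+ c. h c * indicator (q -` {c} \<inter> space M) x \<partial>count_space UNIV)" ..
  qed
  also have "\<dots> = (\<integral>\<^sup>+ c. \<integral>\<^sup>+ x. h c * indicator (q -` {c} \<inter> space M) x \<partial>M \<partial>count_space UNIV)"
    by (rule nn_integral_count_space_nn_integral) auto
  also have "\<dots> = (\<integral>\<^sup>+ c. h c * emeasure M (q -` {c} \<inter> space M) \<partial>count_space UNIV)"
    by (intro nn_integral_cong nn_integral_cmult_indicator) measurable
  finally show ?thesis .
qed

text \<open>The maps \<open>p\<close> and \<open>q\<close> assign to each point the index of its cell.\<close>

locale discretized_coupling = pair_prob_space M1 M2
  for M1 :: "'a measure" and M2 :: "'b measure" +
  fixes \<pi> :: "('a \<times> 'b) measure" and p :: "'a \<Rightarrow> nat" and q :: "'b \<Rightarrow> nat"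
  assumes coupling: "\<pi> \<in> couplings M1 M2"
    and p[measurable]: "p \<in> M1 \<rightarrow>\<^sub>M count_space UNIV"
    and q[measurable]: "q \<in> M2 \<rightarrow>\<^sub>M count_space UNIV"
begin

lemma sets_coupling[measurable_cong]: "sets \<pi> = sets (M1 \<Otimes>\<^sub>M M2)"
  using coupling by (simp add: couplings_def)

lemma space_coupling: "space \<pi> = space M1 \<times> space M2"
  using sets_eq_imp_space_eq[OF sets_coupling] by (simp add: space_pair_measure)

definition mass1 where "mass1 j = emeasure M1 (p -` {j} \<inter> space M1)"
definition mass2 where "mass2 k = emeasure M2 (q -` {k} \<inter> space M2)"
definition cell_mass where
  "cell_mass j k = emeasure \<pi> ((\<lambda>z. (p (fst z), q (snd z))) -` {(j, k)} \<inter> space \<pi>)"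
definition ratio where "ratio j k = cell_mass j k / (mass1 j * mass2 k)"

lemma cell_mass_le1: "cell_mass j k \<le> mass1 j"
proof -
  have "mass1 j = emeasure (distr \<pi> M1 fst) (p -` {j} \<inter> space M1)"
    using coupling by (simp add: couplings_def mass1_def)
  also have "\<dots> = emeasure \<pi> (fst -` (p -` {j} \<inter> space M1) \<inter> space \<pi>)"
    by (rule emeasure_distr) measurable
  also have "cell_mass j k \<le> \<dots>"
    unfolding cell_mass_def
  proof (rule emeasure_mono)
    show "fst -` (p -` {j} \<inter> space M1) \<inter> space \<pi> \<in> sets \<pi>" by measurable
  qed (auto simp: space_coupling)
  finally show ?thesis .
qed

lemma cell_mass_le2: "cell_mass j k \<le> mass2 k"
proof -
  have "mass2 k = emeasure (distr \<pi> M2 snd) (q -` {k} \<inter> space M2)"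
    using coupling by (simp add: couplings_def mass2_def)
  also have "\<dots> = emeasure \<pi> (snd -` (q -` {k} \<inter> space M2) \<inter> space \<pi>)"
    by (rule emeasure_distr) measurable
  also have "cell_mass j k \<le> \<dots>"
    unfolding cell_mass_def
  proof (rule emeasure_mono)
    show "snd -` (q -` {k} \<inter> space M2) \<inter> space \<pi> \<in> sets \<pi>" by measurable
  qed (auto simp: space_coupling)
  finally show ?thesis .
qed

lemma mass_finite: "mass1 j * mass2 k \<noteq> \<infinity>"
  by (simp add: mass1_def mass2_def ennreal_mult_eq_top_iff)

text \<open>A product of cells that is null for the product measure is null for the coupling as well, because
  the coupling has the right marginals; so the default value of the quotient does no harm.\<close>

lemma ratio_times_mass: "ratio j k * (mass1 j * mass2 k) = cell_mass j k"
proof (cases "mass1 j * mass2 k = 0")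
  case True
  then have "cell_mass j k = 0" using cell_mass_le1[of j k] cell_mass_le2[of j k] by auto
  with True show ?thesis by (simp add: ratio_def)
next
  case False
  then have "mass1 j * mass2 k / (mass1 j * mass2 k) = 1"
    using mass_finite[of j k] by (intro ennreal_divide_self) (auto simp: less_top)
  then show ?thesis
    unfolding ratio_def by (metis ennreal_divide_times ennreal_times_divide mult.commute mult.right_neutral)
qed

lemma ratio_finite: "ratio j k \<noteq> \<infinity>"
proof (cases "mass1 j * mass2 k = 0")
  case True
  then have "cell_mass j k = 0" using cell_mass_le1[of j k] cell_mass_le2[of j k] by auto
  then show ?thesis by (simp add: ratio_def)
next
  case False
  then show ?thesis
    using cell_mass_le1[of j k] unfolding ratio_def
    by (auto simp: ennreal_divide_eq_top_iff mass1_def top_unique)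
qed

text \<open>Replacing the coupling by the density \<open>ratio\<close> changes no integral of a function of the cells: both
  sides are the same double series over cell indices.\<close>

lemma nn_integral_ratio:
  "(\<integral>\<^sup>+ x. \<integral>\<^sup>+ y. h (p x) (q y) * ratio (p x) (q y) \<partial>M2 \<partial>M1)
      = (\<integral>\<^sup>+ z. h (p (fst z)) (q (snd z)) \<partial>\<pi>)"
proof -
  have "(\<integral>\<^sup>+ y. h j (q y) * ratio j (q y) \<partial>M2) = (\<integral>\<^sup>+ k. h j k * ratio j k * mass2 k \<partial>count_space UNIV)" for j
    using nn_integral_countable_valued[OF q, of "\<lambda>k. h j k * ratio j k"] by (simp add: mass2_def)
  then have "(\<integral>\<^sup>+ x. \<integral>\<^sup>+ y. h (p x) (q y) * ratio (p x) (q y) \<partial>M2 \<partial>M1)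
      = (\<integral>\<^sup>+ j. (\<integral>\<^sup>+ k. h j k * ratio j k * mass2 k \<partial>count_space UNIV) * mass1 j \<partial>count_space UNIV)"
    using nn_integral_countable_valued[OF p, of "\<lambda>j. \<integral>\<^sup>+ k. h j k * ratio j k * mass2 k \<partial>count_space UNIV"]
    by (simp add: mass1_def)
  also have "\<dots> = (\<integral>\<^sup>+ j. \<integral>\<^sup>+ k. h j k * (ratio j k * (mass1 j * mass2 k)) \<partial>count_space UNIV \<partial>count_space UNIV)"
    by (subst nn_integral_multc[symmetric]) (auto simp: mult_ac)
  also have "\<dots> = (\<integral>\<^sup>+ c. case_prod h c * case_prod cell_mass c \<partial>count_space UNIV)"
    unfolding ratio_times_mass
    using nn_integral_fst_count_space[of "\<lambda>c. case_prod h c * case_prod cell_mass c"] by simp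
  also have "\<dots> = (\<integral>\<^sup>+ z. case_prod h (p (fst z), q (snd z)) \<partial>\<pi>)"
    by (subst nn_integral_countable_valued[of "\<lambda>z. (p (fst z), q (snd z))" \<pi> "case_prod h"])
      (auto simp: cell_mass_def split_beta)
  finally show ?thesis by simp
qed

text \<open>Test the preceding identity against the indicator of one row of cells.\<close>

lemma nn_integral_ratio1: "(\<integral>\<^sup>+ y. ratio j (q y) \<partial>M2) = (if mass1 j = 0 then 0 else 1)"
proof (cases "mass1 j = 0")
  case True
  then have "cell_mass j k = 0" for k using cell_mass_le1[of j k] by auto
  with True show ?thesis by (simp add: ratio_def)
next
  case False
  have I: "(\<integral>\<^sup>+ x. indicator {j} (p x) * u (p x) \<partial>M1) = u j * mass1 j" for u :: "nat \<Rightarrow> ennreal"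
  proof -
    have "(\<integral>\<^sup>+ x. indicator {j} (p x) * u (p x) \<partial>M1)
        = (\<integral>\<^sup>+ x. u j * indicator (p -` {j} \<inter> space M1) x \<partial>M1)"
      by (intro nn_integral_cong) (auto split: split_indicator)
    also have "\<dots> = u j * mass1 j"
      unfolding mass1_def by (rule nn_integral_cmult_indicator) measurable
    finally show ?thesis .
  qed
  have "(\<integral>\<^sup>+ y. ratio j (q y) \<partial>M2) * mass1 j
      = (\<integral>\<^sup>+ x. \<integral>\<^sup>+ y. indicator {j} (p x) * ratio (p x) (q y) \<partial>M2 \<partial>M1)"
    using I[of "\<lambda>j. \<integral>\<^sup>+ y. ratio j (q y) \<partial>M2"] by (simp add: nn_integral_cmult)
  also have "\<dots> = (\<integral>\<^sup>+ z. indicator {j} (p (fst z)) \<partial>\<pi>)"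
    by (rule nn_integral_ratio[of "\<lambda>i k. indicator {j} i"])
  also have "\<dots> = 1 * mass1 j"
    using measurable_compose[OF p, of "\<lambda>i. indicator {j} i :: ennreal" borel] I[of "\<lambda>_. 1"] nn_integral_couplings(1)[OF coupling, of "\<lambda>x. indicator {j} (p x)"] by simp
  finally have "(\<integral>\<^sup>+ y. ratio j (q y) \<partial>M2) * mass1 j / mass1 j = 1 * mass1 j / mass1 j"
    by simp
  then show ?thesis
    using False by (subst (asm) (1 2) ennreal_mult_divide_eq) (auto simp: mass1_def)
qed

lemma AE_mass1: "AE x in M1. mass1 (p x) \<noteq> 0"
proof -
  have "(\<integral>\<^sup>+ x. indicator {j. mass1 j = 0} (p x) \<partial>M1) = (\<integral>\<^sup>+ j. indicator {j. mass1 j = 0} j * mass1 j \<partial>count_space UNIV)"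
    unfolding mass1_def by (rule nn_integral_countable_valued) measurable
  also have "\<dots> = (\<integral>\<^sup>+ j. 0 \<partial>count_space (UNIV :: nat set))" by (intro nn_integral_cong) auto
  finally have *: "(\<integral>\<^sup>+ x. indicator {j. mass1 j = 0} (p x) \<partial>M1) = 0" by simp
  have "(\<lambda>x. indicator {j. mass1 j = 0} (p x) :: ennreal) \<in> borel_measurable M1"
    by (rule measurable_compose[OF p]) simp
  from nn_integral_0_iff_AE[OF this] * show ?thesis by (auto simp: indicator_def)
qed

end

lemma (in discretized_coupling)
  shows nn_integral_ratio2: "(\<integral>\<^sup>+ x. ratio (p x) k \<partial>M1) = (if mass2 k = 0 then 0 else 1)"
    and AE_mass2: "AE y in M2. mass2 (q y) \<noteq> 0"
proof -
  interpret swap: pair_prob_space M2 M1 ..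
  interpret flip: discretized_coupling M2 M1 "distr \<pi> (M2 \<Otimes>\<^sub>M M1) (\<lambda>z. (snd z, fst z))" q p
    by unfold_locales (auto intro: flip_coupling coupling)
  have mass: "flip.mass1 = mass2" "flip.mass2 = mass1"
    by (auto simp: flip.mass1_def flip.mass2_def mass1_def mass2_def)
  have "flip.cell_mass k j = cell_mass j k" for j k
  proof -
    let ?A = "(\<lambda>z. (q (fst z), p (snd z))) -` {(k, j)} \<inter> space (M2 \<Otimes>\<^sub>M M1)"
    have "(\<lambda>z. (q (fst z), p (snd z))) \<in> M2 \<Otimes>\<^sub>M M1 \<rightarrow>\<^sub>M count_space UNIV"
      by measurable
    then have A: "?A \<in> sets (M2 \<Otimes>\<^sub>M M1)"
      by (rule measurable_sets) simp
    have flip: "(\<lambda>z. (snd z, fst z)) \<in> \<pi> \<rightarrow>\<^sub>M M2 \<Otimes>\<^sub>M M1" by measurable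
    have "(\<lambda>z. (snd z, fst z)) -` ?A \<inter> space \<pi> = (\<lambda>z. (p (fst z), q (snd z))) -` {(j, k)} \<inter> space \<pi>"
      by (auto simp: space_coupling space_pair_measure)
    then show ?thesis
      unfolding flip.cell_mass_def cell_mass_def space_distr emeasure_distr[OF flip A] by simp
  qed
  then have "flip.ratio k j = ratio j k" for j k
    by (simp add: flip.ratio_def ratio_def mass mult.commute)
  then show "(\<integral>\<^sup>+ x. ratio (p x) k \<partial>M1) = (if mass2 k = 0 then 0 else 1)"
    "AE y in M2. mass2 (q y) \<noteq> 0"
    using flip.nn_integral_ratio1[of k] flip.AE_mass1 by (simp_all add: mass)
qed

definition dyadic_floor :: "nat \<Rightarrow> ennreal \<Rightarrow> nat" where
  "dyadic_floor n t = nat \<lfloor>2 ^ n * enn2real t\<rfloor>"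

lemma dyadic_floor_le:
  assumes "t \<noteq> \<infinity>"
  shows "ennreal (real (dyadic_floor n t) / 2 ^ n) \<le> t"
proof -
  obtain r where t: "t = ennreal r" "r \<ge> 0" using assms by (cases t) auto
  have "real (dyadic_floor n t) \<le> 2 ^ n * r"
    using t by (simp add: dyadic_floor_def)
  then show ?thesis using t by (auto intro!: ennreal_leI simp: field_simps)
qed

lemma dyadic_floor_tendsto:
  assumes "t \<noteq> \<infinity>"
  shows "(\<lambda>n. ennreal (real (dyadic_floor n t) / 2 ^ n)) \<longlonglongrightarrow> t"
proof -
  obtain r where t: "t = ennreal r" "r \<ge> 0" using assms by (cases t) auto
  have "(\<lambda>n. real (dyadic_floor n t) / 2 ^ n) \<longlonglongrightarrow> r"
  proof (rule tendsto_sandwich)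
    show "\<forall>\<^sub>F n in sequentially. r - 1 / 2 ^ n \<le> real (dyadic_floor n t) / 2 ^ n"
    proof (intro always_eventually allI)
      fix n
      have "2 ^ n * r - 1 \<le> real (dyadic_floor n t)"
        using t by (simp add: dyadic_floor_def)
      then have "(2 ^ n * r - 1) / 2 ^ n \<le> real (dyadic_floor n t) / 2 ^ n"
        by (rule divide_right_mono) simp
      then show "r - 1 / 2 ^ n \<le> real (dyadic_floor n t) / 2 ^ n" by (simp add: diff_divide_distrib)
    qed
    show "\<forall>\<^sub>F n in sequentially. real (dyadic_floor n t) / 2 ^ n \<le> r"
    proof (intro always_eventually allI)
      fix n
      have "real (dyadic_floor n t) \<le> 2 ^ n * r"
        using t by (simp add: dyadic_floor_def)
      then show "real (dyadic_floor n t) / 2 ^ n \<le> r" by (simp add: field_simps)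
    qed
    show "(\<lambda>n. r - 1 / 2 ^ n) \<longlonglongrightarrow> r"
      using tendsto_diff[OF tendsto_const LIMSEQ_divide_realpow_zero[of 2 1], of r] by simp
  qed simp
  then show ?thesis unfolding t(1) by (rule tendsto_ennrealI)
qed

context discretized_coupling
begin

text \<open>Rounding down keeps the marginals below those of the coupling; the truncation leaves finitely many
  dyadic values, hence countably many possible tables.\<close>

definition step_ratio :: "nat \<Rightarrow> nat \<Rightarrow> nat \<Rightarrow> ennreal" where
  "step_ratio n j k =
     (if j < n \<and> k < n then ennreal (real (dyadic_floor n (ratio j k)) / 2 ^ n) else 0)"

lemma step_ratio_le: "step_ratio n j k \<le> ratio j k"
  using ratio_finite dyadic_floor_le by (auto simp: step_ratio_def)

lemma step_ratio_tendsto: "(\<lambda>n. step_ratio n j k) \<longlonglongrightarrow> ratio j k"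
proof (rule Lim_transform_eventually)
  show "(\<lambda>n. ennreal (real (dyadic_floor n (ratio j k)) / 2 ^ n)) \<longlonglongrightarrow> ratio j k"
    by (rule dyadic_floor_tendsto[OF ratio_finite])
  show "\<forall>\<^sub>F n in sequentially. ennreal (real (dyadic_floor n (ratio j k)) / 2 ^ n) = step_ratio n j k"
    using eventually_gt_at_top[of "max j k"] by eventually_elim (auto simp: step_ratio_def)
qed

lemma measurable_cells:
  fixes h :: "nat \<Rightarrow> nat \<Rightarrow> ennreal"
  shows "(\<lambda>z. h (p (fst z)) (q (snd z))) \<in> borel_measurable (M1 \<Otimes>\<^sub>M M2)"
    "(\<lambda>y. h j (q y)) \<in> borel_measurable M2" "(\<lambda>x. h (p x) k) \<in> borel_measurable M1"
    "(\<lambda>x. \<integral>\<^sup>+ y. h (p x) (q y) \<partial>M2) \<in> borel_measurable M1"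
    "(\<lambda>y. \<integral>\<^sup>+ x. h (p x) (q y) \<partial>M1) \<in> borel_measurable M2"
proof -
  show "(\<lambda>z. h (p (fst z)) (q (snd z))) \<in> borel_measurable (M1 \<Otimes>\<^sub>M M2)"
    using measurable_compose[of "\<lambda>z. (p (fst z), q (snd z))" "M1 \<Otimes>\<^sub>M M2" "count_space UNIV" "case_prod h" borel]
    by simp
qed (rule measurable_compose[OF q] measurable_compose[OF p], simp)+

lemma step_ratio_marginal1_le: "(\<integral>\<^sup>+ y. step_ratio n j (q y) \<partial>M2) \<le> 1"
proof -
  have "(\<integral>\<^sup>+ y. step_ratio n j (q y) \<partial>M2) \<le> (\<integral>\<^sup>+ y. ratio j (q y) \<partial>M2)"
    by (intro nn_integral_mono step_ratio_le)
  also have "\<dots> \<le> 1" by (simp add: nn_integral_ratio1)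
  finally show ?thesis .
qed

lemma step_ratio_marginal2_le: "(\<integral>\<^sup>+ x. step_ratio n (p x) k \<partial>M1) \<le> 1"
proof -
  have "(\<integral>\<^sup>+ x. step_ratio n (p x) k \<partial>M1) \<le> (\<integral>\<^sup>+ x. ratio (p x) k \<partial>M1)"
    by (intro nn_integral_mono step_ratio_le)
  also have "\<dots> \<le> 1" by (simp add: nn_integral_ratio2)
  finally show ?thesis .
qed

lemma step_ratio_marginal1_tendsto:
  "(\<lambda>n. \<integral>\<^sup>+ y. step_ratio n j (q y) \<partial>M2) \<longlonglongrightarrow> (\<integral>\<^sup>+ y. ratio j (q y) \<partial>M2)"
  by (rule nn_integral_dominated_convergence[where w="\<lambda>y. ratio j (q y)"])
    (auto intro!: measurable_cells simp: step_ratio_le step_ratio_tendsto nn_integral_ratio1)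

lemma step_ratio_marginal2_tendsto:
  "(\<lambda>n. \<integral>\<^sup>+ x. step_ratio n (p x) k \<partial>M1) \<longlonglongrightarrow> (\<integral>\<^sup>+ x. ratio (p x) k \<partial>M1)"
  by (rule nn_integral_dominated_convergence[where w="\<lambda>x. ratio (p x) k"])
    (auto intro!: measurable_cells simp: step_ratio_le step_ratio_tendsto nn_integral_ratio2)

text \<open>The deficit of the rounded density tends to \<open>0\<close> pointwise and is at most \<open>1\<close>, so a finite integral of
  \<open>u\<close> allows dominated convergence. This is where finite second moments enter, with \<open>u\<close> the squared norm.\<close>

lemma residual1_tendsto_0:
  assumes u[measurable]: "u \<in> borel_measurable M1" and fin: "(\<integral>\<^sup>+ x. u x \<partial>M1) < \<infinity>"
  shows "(\<lambda>n. \<integral>\<^sup>+ x. u x * (1 - (\<integral>\<^sup>+ y. step_ratio n (p x) (q y) \<partial>M2)) \<partial>M1) \<longlonglongrightarrow> 0"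
proof -
  have "AE x in M1. u x \<noteq> \<infinity>"
    using nn_integral_PInf_AE[OF u] fin by auto
  then have "AE x in M1. (\<lambda>n. u x * (1 - (\<integral>\<^sup>+ y. step_ratio n (p x) (q y) \<partial>M2))) \<longlonglongrightarrow> 0"
    using AE_mass1
  proof eventually_elim
    case (elim x)
    then have "u x < top" by (metis infinity_ennreal_def top.not_eq_extremum)
    have "(\<lambda>n. u x * (1 - (\<integral>\<^sup>+ y. step_ratio n (p x) (q y) \<partial>M2)))
        \<longlonglongrightarrow> u x * (1 - (\<integral>\<^sup>+ y. ratio (p x) (q y) \<partial>M2))"
      using \<open>u x < top\<close> by (intro ennreal_tendsto_cmult tendsto_diff_ennreal tendsto_const step_ratio_marginal1_tendsto
          step_ratio_marginal1_le) (auto simp: nn_integral_ratio1 nn_integral_ratio2)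
    with elim show ?case by (simp add: nn_integral_ratio1)
  qed
  then have "(\<lambda>n. \<integral>\<^sup>+ x. u x * (1 - (\<integral>\<^sup>+ y. step_ratio n (p x) (q y) \<partial>M2)) \<partial>M1)
      \<longlonglongrightarrow> (\<integral>\<^sup>+ x. 0 \<partial>M1)"
    using fin by (intro nn_integral_dominated_convergence[where w=u])
      (auto intro!: measurable_cells borel_measurable_times_ennreal borel_measurable_minus_ennreal simp: ennreal_mult_right_le)
  then show ?thesis by simp
qed

lemma residual2_tendsto_0:
  assumes u[measurable]: "u \<in> borel_measurable M2" and fin: "(\<integral>\<^sup>+ y. u y \<partial>M2) < \<infinity>"
  shows "(\<lambda>n. \<integral>\<^sup>+ y. u y * (1 - (\<integral>\<^sup>+ x. step_ratio n (p x) (q y) \<partial>M1)) \<partial>M2) \<longlonglongrightarrow> 0"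
proof -
  have "AE y in M2. u y \<noteq> \<infinity>"
    using nn_integral_PInf_AE[OF u] fin by auto
  then have "AE y in M2. (\<lambda>n. u y * (1 - (\<integral>\<^sup>+ x. step_ratio n (p x) (q y) \<partial>M1))) \<longlonglongrightarrow> 0"
    using AE_mass2
  proof eventually_elim
    case (elim y)
    then have "u y < top" by (metis infinity_ennreal_def top.not_eq_extremum)
    have "(\<lambda>n. u y * (1 - (\<integral>\<^sup>+ x. step_ratio n (p x) (q y) \<partial>M1)))
        \<longlonglongrightarrow> u y * (1 - (\<integral>\<^sup>+ x. ratio (p x) (q y) \<partial>M1))"
      using \<open>u y < top\<close> by (intro ennreal_tendsto_cmult tendsto_diff_ennreal tendsto_const step_ratio_marginal2_tendsto
          step_ratio_marginal2_le) (auto simp: nn_integral_ratio1 nn_integral_ratio2)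
    with elim show ?case by (simp add: nn_integral_ratio2)
  qed
  then have "(\<lambda>n. \<integral>\<^sup>+ y. u y * (1 - (\<integral>\<^sup>+ x. step_ratio n (p x) (q y) \<partial>M1)) \<partial>M2)
      \<longlonglongrightarrow> (\<integral>\<^sup>+ y. 0 \<partial>M2)"
    using fin by (intro nn_integral_dominated_convergence[where w=u])
      (auto intro!: measurable_cells borel_measurable_times_ennreal borel_measurable_minus_ennreal simp: ennreal_mult_right_le)
  then show ?thesis by simp
qed

end

section \<open>Countably many densities suffice for the Wasserstein distance\<close>

definition dense_seq :: "nat \<Rightarrow> 'a::{second_countable_topology, metric_space}" where
  "dense_seq = (SOME d. \<forall>S. open S \<longrightarrow> S \<noteq> {} \<longrightarrow> (\<exists>j. d j \<in> S))"

lemma dense_seq: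
  fixes S :: "'a::{second_countable_topology, metric_space} set"
  assumes "open S" "S \<noteq> {}"
  shows "\<exists>j. dense_seq j \<in> S"
proof -
  obtain D :: "'a set" where D: "countable D" "\<And>S. open S \<Longrightarrow> S \<noteq> {} \<Longrightarrow> \<exists>d\<in>D. d \<in> S"
    using countable_dense_setE by blast
  have "\<exists>d. \<forall>S::'a set. open S \<longrightarrow> S \<noteq> {} \<longrightarrow> (\<exists>j::nat. d j \<in> S)"
    using D by (metis from_nat_into_to_nat_on)
  from someI_ex[OF this, folded dense_seq_def] assms show ?thesis
    by simp
qed

text \<open>Choosing the first point of a fixed dense sequence within distance \<open>1/(l+1)\<close> partitions the space into
  countably many Borel cells of small diameter.\<close>

definition grid_cell :: "nat \<Rightarrow> 'a::{second_countable_topology, metric_space} \<Rightarrow> nat" where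
  "grid_cell l x = (LEAST j. dist x (dense_seq j) < 1 / real (Suc l))"

lemma dist_grid_cell: "dist x (dense_seq (grid_cell l x)) < 1 / real (Suc l)"
proof -
  have "\<exists>j. dense_seq j \<in> ball x (1 / real (Suc l))" by (rule dense_seq) auto
  then have "\<exists>j. dist x (dense_seq j) < 1 / real (Suc l)" by (simp only: mem_ball)
  from LeastI_ex[OF this] show ?thesis unfolding grid_cell_def .
qed

lemma measurable_grid_cell[measurable]: "grid_cell l \<in> borel \<rightarrow>\<^sub>M count_space UNIV"
  unfolding grid_cell_def by measurable

text \<open>A finite table of naturals, read as dyadic values with denominator \<open>2\<^sup>n\<close> and extended by \<open>0\<close>. Lists are
  used so that the type of tables is countable.\<close>

definition table_weight :: "nat \<Rightarrow> nat list list \<Rightarrow> nat \<Rightarrow> nat \<Rightarrow> ennreal" where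
  "table_weight n L j k =
     (if j < length L \<and> k < length (L ! j) then ennreal (real (L ! j ! k) / 2 ^ n) else 0)"

text \<open>A table need not suit a given pair of measures. Replacing it by \<open>0\<close> when a marginal would exceed \<open>1\<close>
  lets one list of tables serve all pairs. The test ranges over cells, hence countably many conditions,
  which keeps it measurable in \<open>M\<close> and \<open>N\<close>.\<close>

definition table_density :: "nat \<Rightarrow> (nat \<Rightarrow> nat \<Rightarrow> ennreal) \<Rightarrow>
    'a::{second_countable_topology, metric_space} measure \<Rightarrow> 'a measure \<Rightarrow> 'a \<Rightarrow> 'a \<Rightarrow> ennreal" where
  "table_density l w M N x y =
     (if (\<forall>j. (\<integral>\<^sup>+ y. w j (grid_cell l y) \<partial>N) \<le> 1) \<and> (\<forall>k. (\<integral>\<^sup>+ x. w (grid_cell l x) k \<partial>M) \<le> 1)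
      then w (grid_cell l x) (grid_cell l y) else 0)"

text \<open>A natural number encodes a mesh \<open>l\<close>, a denominator exponent \<open>n\<close> and a table \<open>L\<close>.\<close>

definition grid_density :: "nat \<Rightarrow>
    'a::{second_countable_topology, metric_space} measure \<Rightarrow> 'a measure \<Rightarrow> 'a \<Rightarrow> 'a \<Rightarrow> ennreal" where
  "grid_density i M N = (case from_nat i of (l, n, L) \<Rightarrow>
     residual_completion M N (table_density l (table_weight n L) M N))"

lemma measurable_grid_cell_pair:
  fixes w :: "nat \<Rightarrow> nat \<Rightarrow> ennreal"
  assumes [measurable]: "f \<in> M \<rightarrow>\<^sub>M borel" "g \<in> M \<rightarrow>\<^sub>M borel"
  shows "(\<lambda>z. w (grid_cell l (f z)) (grid_cell l (g z))) \<in> borel_measurable M"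
proof -
  have "(\<lambda>z. (grid_cell l (f z), grid_cell l (g z))) \<in> M \<rightarrow>\<^sub>M count_space UNIV"
    by measurable
  from measurable_compose[OF this, of "case_prod w"] show ?thesis by simp
qed

context borel_pair
begin

lemma subcoupling_table_density: "subcoupling_density M1 M2 (table_density l w M1 M2)"
proof -
  define C where "C \<longleftrightarrow> (\<forall>j. (\<integral>\<^sup>+ y. w j (grid_cell l y) \<partial>M2) \<le> 1)
      \<and> (\<forall>k. (\<integral>\<^sup>+ x. w (grid_cell l x) k \<partial>M1) \<le> 1)"
  have eq: "table_density l w M1 M2 = (\<lambda>x y. if C then w (grid_cell l x) (grid_cell l y) else 0)"
    by (simp add: fun_eq_iff table_density_def C_def)
  have "(\<lambda>z. w (grid_cell l (fst z)) (grid_cell l (snd z))) \<in> borel_measurable (M1 \<Otimes>\<^sub>M M2)"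
    by (rule measurable_grid_cell_pair) measurable
  then have "case_prod (table_density l w M1 M2) \<in> borel_measurable (M1 \<Otimes>\<^sub>M M2)"
    by (cases C) (simp_all add: eq split_beta)
  moreover have "(\<integral>\<^sup>+ y. table_density l w M1 M2 x y \<partial>M2) \<le> 1" for x
    by (cases C) (simp_all add: eq, simp add: C_def)
  moreover have "(\<integral>\<^sup>+ x. table_density l w M1 M2 x y \<partial>M1) \<le> 1" for y
    by (cases C) (simp_all add: eq, simp add: C_def)
  ultimately show ?thesis by unfold_locales
qed

lemma coupling_density_grid_density: "coupling_density M1 M2 (grid_density i M1 M2)"
proof (cases "from_nat i :: nat \<times> nat \<times> nat list list")
  case (fields l n L)
  then show ?thesis unfolding grid_density_def
    using subcoupling_density.coupling_density_residual_completion[OF subcoupling_table_density]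
    by simp
qed

text \<open>The completed roundings of \<open>ratio\<close> belong to the countable family, and the cost of completing them
  vanishes in the limit.\<close>

lemma INF_grid_density_le_ratio:
  assumes fin: "second_moment M1 < \<infinity>" "second_moment M2 < \<infinity>"
    and dc: "discretized_coupling M1 M2 \<pi> (grid_cell l) (grid_cell l)"
  shows "(INF i. square_cost M1 M2 (grid_density i M1 M2))
    \<le> square_cost M1 M2 (\<lambda>x y. discretized_coupling.ratio M1 M2 \<pi> (grid_cell l) (grid_cell l)
        (grid_cell l x) (grid_cell l y))" (is "?I \<le> ?R")
proof -
  interpret discretized_coupling M1 M2 \<pi> "grid_cell l" "grid_cell l" by (rule dc)
  let ?f = "\<lambda>n x y. step_ratio n (grid_cell l x) (grid_cell l y)"
  let ?a = "\<lambda>n. \<integral>\<^sup>+ x. ennreal ((norm x)\<^sup>2) * (1 - (\<integral>\<^sup>+ y. ?f n x y \<partial>M2)) \<partial>M1"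
  let ?b = "\<lambda>n. \<integral>\<^sup>+ y. ennreal ((norm y)\<^sup>2) * (1 - (\<integral>\<^sup>+ x. ?f n x y \<partial>M1)) \<partial>M2"
  have "?I \<le> ?R + 2 * ?a n + 2 * ?b n" for n
  proof -
    \<comment> \<open>The table of the roundings passes the admissibility test, so \<open>table_density\<close> leaves it unchanged.\<close>
    let ?L = "map (\<lambda>j. map (\<lambda>k. dyadic_floor n (ratio j k)) [0..<n]) [0..<n]"
    have w: "table_weight n ?L = step_ratio n"
      by (auto simp: fun_eq_iff table_weight_def step_ratio_def)
    have f: "table_density l (step_ratio n) M1 M2 = ?f n"
      by (auto simp: fun_eq_iff table_density_def step_ratio_marginal1_le step_ratio_marginal2_le)
    have "?I \<le> square_cost M1 M2 (grid_density (to_nat (l, n, ?L)) M1 M2)"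
      by (rule INF_lower) simp
    also have "\<dots> = square_cost M1 M2 (residual_completion M1 M2 (?f n))"
      unfolding grid_density_def by (simp only: from_nat_to_nat prod.case w f)
    also have "\<dots> \<le> square_cost M1 M2 (?f n) + 2 * ?a n + 2 * ?b n"
      using subcoupling_table_density[of l "step_ratio n"]
      by (intro square_cost_residual_completion_le) (simp add: f)
    also have "square_cost M1 M2 (?f n) \<le> ?R"
      unfolding square_cost_def by (intro nn_integral_mono mult_left_mono step_ratio_le) auto
    finally show ?thesis by (simp add: add_right_mono)
  qed
  moreover have "(\<lambda>n. ?R + 2 * ?a n + 2 * ?b n) \<longlonglongrightarrow> ?R + 2 * 0 + 2 * 0"
    using fin unfolding second_moment_def
    by (intro tendsto_add tendsto_const ennreal_tendsto_cmult residual1_tendsto_0 residual2_tendsto_0) auto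
  ultimately show ?thesis by (intro LIMSEQ_le_const[where X="\<lambda>n. ?R + 2 * ?a n + 2 * ?b n"]) auto
qed

text \<open>Moving both points to the centres of their cells changes the distance by at most \<open>2h\<close>, once to pass
  from the points to the cells and once to pass back; in between, \<open>ratio\<close> and the coupling have the
  same integrals. The cross term \<open>8h d\<close> is absorbed by \<open>d \<le> 1 + d\<^sup>2\<close>.\<close>

lemma square_cost_ratio_le:
  assumes dc: "discretized_coupling M1 M2 \<pi> (grid_cell l) (grid_cell l)"
  defines "h \<equiv> 1 / real (Suc l)"
  shows "square_cost M1 M2 (\<lambda>x y. discretized_coupling.ratio M1 M2 \<pi> (grid_cell l) (grid_cell l)
        (grid_cell l x) (grid_cell l y))
    \<le> ennreal (1 + 8 * h) * (\<integral>\<^sup>+ z. ennreal ((dist (fst z) (snd z))\<^sup>2) \<partial>\<pi>) + ennreal (8 * h + 16 * h\<^sup>2)"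
proof -
  interpret discretized_coupling M1 M2 \<pi> "grid_cell l" "grid_cell l" by (rule dc)
  have h: "h \<ge> 0" by (simp add: h_def)
  let ?d = "\<lambda>j k. dist (dense_seq j) (dense_seq k :: 'a) + 2 * h"
  have near: "dist x (dense_seq (grid_cell l x)) \<le> h" for x :: 'a
    using dist_grid_cell[of x l] by (simp add: h_def)
  \<comment> \<open>\<open>?d j k\<close> bounds the distance on the product of cells \<open>j\<close> and \<open>k\<close> from above.\<close>
  have upper: "(dist x y)\<^sup>2 \<le> (?d (grid_cell l x) (grid_cell l y))\<^sup>2" for x y :: 'a
    using near[of x] near[of y] h
      dist_triangle[of x y "dense_seq (grid_cell l x)"]
      dist_triangle[of "dense_seq (grid_cell l x)" y "dense_seq (grid_cell l y)"]
    by (intro power_mono) (auto simp: dist_commute)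
  have lower: "(?d (grid_cell l x) (grid_cell l y))\<^sup>2 \<le> (1 + 8 * h) * (dist x y)\<^sup>2 + (8 * h + 16 * h\<^sup>2)"
    for x y :: 'a
  proof -
    have "?d (grid_cell l x) (grid_cell l y) \<le> dist x y + 4 * h"
      using near[of x] near[of y]
        dist_triangle[of "dense_seq (grid_cell l x)" "dense_seq (grid_cell l y)" x]
        dist_triangle[of x "dense_seq (grid_cell l y)" y]
      by (auto simp: dist_commute)
    then have "(?d (grid_cell l x) (grid_cell l y))\<^sup>2 \<le> (dist x y + 4 * h)\<^sup>2"
      using h by (intro power_mono) auto
    also have "\<dots> = (dist x y)\<^sup>2 + 8 * h * dist x y + 16 * h\<^sup>2"
      by (simp add: power2_eq_square algebra_simps)
    also have "8 * h * dist x y \<le> 8 * h * (1 + (dist x y)\<^sup>2)"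
    proof (intro mult_left_mono)
      have "0 \<le> (dist x y - 1)\<^sup>2" by simp
      then have "2 * dist x y \<le> 1 + (dist x y)\<^sup>2" by (simp add: power2_diff)
      then show "dist x y \<le> 1 + (dist x y)\<^sup>2"
        using zero_le_dist[of x y] by linarith
    qed (use h in auto)
    finally show ?thesis by (simp add: algebra_simps)
  qed
  have "square_cost M1 M2 (\<lambda>x y. ratio (grid_cell l x) (grid_cell l y))
      \<le> (\<integral>\<^sup>+ x. \<integral>\<^sup>+ y. ennreal ((?d (grid_cell l x) (grid_cell l y))\<^sup>2)
            * ratio (grid_cell l x) (grid_cell l y) \<partial>M2 \<partial>M1)"
    unfolding square_cost_def by (intro nn_integral_mono mult_right_mono ennreal_leI upper) auto
  also have "\<dots> = (\<integral>\<^sup>+ z. ennreal ((?d (grid_cell l (fst z)) (grid_cell l (snd z)))\<^sup>2) \<partial>\<pi>)"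
    by (rule nn_integral_ratio)
  also have "\<dots> \<le> (\<integral>\<^sup>+ z. ennreal (1 + 8 * h) * ennreal ((dist (fst z) (snd z))\<^sup>2)
      + ennreal (8 * h + 16 * h\<^sup>2) \<partial>\<pi>)"
  proof (intro nn_integral_mono)
    fix z :: "'a \<times> 'a"
    have "ennreal (1 + 8 * h) * ennreal ((dist (fst z) (snd z))\<^sup>2) + ennreal (8 * h + 16 * h\<^sup>2)
        = ennreal ((1 + 8 * h) * (dist (fst z) (snd z))\<^sup>2 + (8 * h + 16 * h\<^sup>2))"
      using h by (simp add: ennreal_mult[symmetric] ennreal_plus[symmetric] del: ennreal_plus)
    then show "ennreal ((?d (grid_cell l (fst z)) (grid_cell l (snd z)))\<^sup>2)
        \<le> ennreal (1 + 8 * h) * ennreal ((dist (fst z) (snd z))\<^sup>2) + ennreal (8 * h + 16 * h\<^sup>2)"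
      using ennreal_leI[OF lower] by simp
  qed
  also have "\<dots> = ennreal (1 + 8 * h) * (\<integral>\<^sup>+ z. ennreal ((dist (fst z) (snd z))\<^sup>2) \<partial>\<pi>)
      + ennreal (8 * h + 16 * h\<^sup>2) * emeasure \<pi> (space \<pi>)"
    by (simp add: nn_integral_add nn_integral_cmult)
  also have "emeasure \<pi> (space \<pi>) = 1"
    using couplings_prob_space[OF coupling M1.prob_space_axioms] by (rule prob_space.emeasure_space_1)
  finally show ?thesis by simp
qed

theorem wasserstein2_eq_INF_grid_density:
  assumes fin: "second_moment M1 < \<infinity>" "second_moment M2 < \<infinity>"
  shows "(wasserstein2 dist M1 M2)\<^sup>2 = (INF i. square_cost M1 M2 (grid_density i M1 M2))"
proof (rule antisym)
  show "(wasserstein2 dist M1 M2)\<^sup>2 \<le> (INF i. square_cost M1 M2 (grid_density i M1 M2))"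
    by (intro INF_greatest wasserstein2_le_density coupling_density_grid_density)
  show "(INF i. square_cost M1 M2 (grid_density i M1 M2)) \<le> (wasserstein2 dist M1 M2)\<^sup>2"
    (is "?I \<le> _")
    unfolding wasserstein2_def ennreal_sqrt_power2
  proof (rule INF_greatest)
    fix \<pi> assume \<pi>: "\<pi> \<in> couplings M1 M2"
    let ?C = "\<integral>\<^sup>+ z. ennreal ((dist (fst z) (snd z))\<^sup>2) \<partial>\<pi>"
    let ?h = "\<lambda>l. 1 / real (Suc l)"
    show "?I \<le> ?C"
    proof (cases "?C = \<infinity>")
      case False
      have "?I \<le> ennreal (1 + 8 * ?h l) * ?C + ennreal (8 * ?h l + 16 * (?h l)\<^sup>2)" for l
      proof -
        have "discretized_coupling M1 M2 \<pi> (grid_cell l) (grid_cell l)"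
          using \<pi> by unfold_locales auto
        from INF_grid_density_le_ratio[OF fin this] square_cost_ratio_le[OF this]
        show ?thesis by (rule order_trans)
      qed
      moreover have "(\<lambda>l. ?C * ennreal (1 + 8 * ?h l) + ennreal (8 * ?h l + 16 * (?h l)\<^sup>2))
          \<longlonglongrightarrow> ?C * ennreal (1 + 8 * 0) + ennreal (8 * 0 + 16 * 0\<^sup>2)"
      proof -
        have h: "?h \<longlonglongrightarrow> 0"
          using LIMSEQ_inverse_real_of_nat by (simp add: inverse_eq_divide)
        have C: "?C < top" using False by (metis infinity_ennreal_def top.not_eq_extremum)
        show ?thesis
          by (intro tendsto_add ennreal_tendsto_cmult[OF C] tendsto_ennrealI tendsto_mult tendsto_power
              tendsto_const h)
      qed
      ultimately show ?thesis
        by (intro LIMSEQ_le_const[where X="\<lambda>l. ?C * ennreal (1 + 8 * ?h l) + ennreal (8 * ?h l + 16 * (?h l)\<^sup>2)"])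
          (simp_all add: mult.commute)
    qed simp
  qed
qed

end

section \<open>Measurable selection of near-optimal couplings\<close>

text \<open>Every ingredient of the density is an integral with respect to one of the kernels, hence measurable
  jointly in the parameter and the two points.\<close>

lemma measurable_residual_completion_kernel:
  assumes \<kappa>: "\<kappa> \<in> Z \<rightarrow>\<^sub>M subprob_algebra S" and \<mu>: "\<mu> \<in> Z \<rightarrow>\<^sub>M subprob_algebra T"
    and f: "(\<lambda>(z, x, y). f z x y) \<in> borel_measurable (Z \<Otimes>\<^sub>M S \<Otimes>\<^sub>M T)"
  shows "(\<lambda>(z, x, y). residual_completion (\<kappa> z) (\<mu> z) (f z) x y) \<in> borel_measurable (Z \<Otimes>\<^sub>M S \<Otimes>\<^sub>M T)"
proof -
  have 1: "(\<lambda>w. \<integral>\<^sup>+ y. f (fst w) (fst (snd w)) y \<partial>\<mu> (fst w)) \<in> borel_measurable (Z \<Otimes>\<^sub>M S \<Otimes>\<^sub>M T)"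
    by (rule nn_integral_measurable_subprob_algebra2[where N=T])
      (use measurable_compose[OF _ f, of "\<lambda>w. (fst (fst w), fst (snd (fst w)), snd w)" "(Z \<Otimes>\<^sub>M S \<Otimes>\<^sub>M T) \<Otimes>\<^sub>M T"] \<mu>
        in \<open>simp_all add: split_beta\<close>)
  have 2: "(\<lambda>w. \<integral>\<^sup>+ x. f (fst w) x (snd (snd w)) \<partial>\<kappa> (fst w)) \<in> borel_measurable (Z \<Otimes>\<^sub>M S \<Otimes>\<^sub>M T)"
    by (rule nn_integral_measurable_subprob_algebra2[where N=S])
      (use measurable_compose[OF _ f, of "\<lambda>w. (fst (fst w), snd w, snd (snd (fst w)))" "(Z \<Otimes>\<^sub>M S \<Otimes>\<^sub>M T) \<Otimes>\<^sub>M S"] \<kappa>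
        in \<open>simp_all add: split_beta\<close>)
  have "(\<lambda>w. \<integral>\<^sup>+ y. f (fst w) (snd w) y \<partial>\<mu> (fst w)) \<in> borel_measurable (Z \<Otimes>\<^sub>M S)"
    by (rule nn_integral_measurable_subprob_algebra2[where N=T])
      (use measurable_compose[OF _ f, of "\<lambda>w. (fst (fst w), snd (fst w), snd w)" "(Z \<Otimes>\<^sub>M S) \<Otimes>\<^sub>M T"] \<mu>
        in \<open>simp_all add: split_beta\<close>)
  then have "(\<lambda>z. \<integral>\<^sup>+ x. \<integral>\<^sup>+ y. f z x y \<partial>\<mu> z \<partial>\<kappa> z) \<in> borel_measurable Z"
    by (intro nn_integral_measurable_subprob_algebra2[where N=S] \<kappa>) (simp add: split_beta)
  then have 3: "(\<lambda>w. \<integral>\<^sup>+ x. \<integral>\<^sup>+ y. f (fst w) x y \<partial>\<mu> (fst w) \<partial>\<kappa> (fst w)) \<in> borel_measurable (Z \<Otimes>\<^sub>M S \<Otimes>\<^sub>M T)"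
    by measurable
  show ?thesis
    using f 1 2 3 unfolding residual_completion_def split_beta by measurable
qed

lemma measurable_table_density_kernel:
  fixes \<kappa> \<mu> :: "'z \<Rightarrow> 'a::{second_countable_topology, metric_space} measure"
  assumes \<kappa>: "\<kappa> \<in> Z \<rightarrow>\<^sub>M subprob_algebra borel" and \<mu>: "\<mu> \<in> Z \<rightarrow>\<^sub>M subprob_algebra borel"
  shows "(\<lambda>(z, x, y). table_density l w (\<kappa> z) (\<mu> z) x y) \<in> borel_measurable (Z \<Otimes>\<^sub>M borel \<Otimes>\<^sub>M borel)"
proof -
  have [measurable]: "(\<lambda>y. h (grid_cell l (y::'a))) \<in> borel_measurable borel" for h :: "nat \<Rightarrow> ennreal"
    by (rule measurable_compose[OF measurable_grid_cell]) simp
  have [measurable]: "(\<lambda>z. \<integral>\<^sup>+ y. w j (grid_cell l y) \<partial>\<mu> z) \<in> borel_measurable Z"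
      "(\<lambda>z. \<integral>\<^sup>+ x. w (grid_cell l x) j \<partial>\<kappa> z) \<in> borel_measurable Z" for j
    by (rule measurable_compose[OF \<mu> nn_integral_measurable_subprob_algebra]
        measurable_compose[OF \<kappa> nn_integral_measurable_subprob_algebra], simp)+
  have [measurable]: "(\<lambda>p. w (grid_cell l (fst (snd p))) (grid_cell l (snd (snd p))))
      \<in> borel_measurable (Z \<Otimes>\<^sub>M borel \<Otimes>\<^sub>M borel)"
    by (rule measurable_grid_cell_pair) measurable
  show ?thesis
    unfolding table_density_def split_beta by measurable
qed

lemma measurable_grid_density_kernel:
  fixes \<kappa> \<mu> :: "'z \<Rightarrow> 'a::{second_countable_topology, metric_space} measure"
  assumes \<kappa>: "\<kappa> \<in> Z \<rightarrow>\<^sub>M subprob_algebra borel" and \<mu>: "\<mu> \<in> Z \<rightarrow>\<^sub>M subprob_algebra borel"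
  shows "(\<lambda>(z, x, y). grid_density i (\<kappa> z) (\<mu> z) x y) \<in> borel_measurable (Z \<Otimes>\<^sub>M borel \<Otimes>\<^sub>M borel)"
proof (cases "from_nat i :: nat \<times> nat \<times> nat list list")
  case (fields l n L)
  then show ?thesis unfolding grid_density_def
    using measurable_residual_completion_kernel[OF \<kappa> \<mu> measurable_table_density_kernel[OF \<kappa> \<mu>]] by simp
qed

lemma measurable_square_cost_kernel:
  fixes \<kappa> \<mu> :: "'z \<Rightarrow> 'a::{second_countable_topology, metric_space} measure"
  assumes \<kappa>: "\<kappa> \<in> Z \<rightarrow>\<^sub>M subprob_algebra borel" and \<mu>: "\<mu> \<in> Z \<rightarrow>\<^sub>M subprob_algebra borel"
    and f: "(\<lambda>(z, x, y). f z x y) \<in> borel_measurable (Z \<Otimes>\<^sub>M borel \<Otimes>\<^sub>M borel)"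
  shows "(\<lambda>z. square_cost (\<kappa> z) (\<mu> z) (f z)) \<in> borel_measurable Z"
proof -
  have "(\<lambda>w. f (fst (fst w)) (snd (fst w)) (snd w)) \<in> borel_measurable ((Z \<Otimes>\<^sub>M borel) \<Otimes>\<^sub>M borel)"
    using measurable_compose[OF _ f, of "\<lambda>w. (fst (fst w), snd (fst w), snd w)" "(Z \<Otimes>\<^sub>M borel) \<Otimes>\<^sub>M borel"]
    by simp
  then have "(\<lambda>w. \<integral>\<^sup>+ y. ennreal ((dist (snd w) y)\<^sup>2) * f (fst w) (snd w) y \<partial>\<mu> (fst w))
      \<in> borel_measurable (Z \<Otimes>\<^sub>M borel)"
    by (intro nn_integral_measurable_subprob_algebra2[where N=borel] measurable_compose[OF measurable_fst \<mu>])
      (simp add: split_beta)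
  then show ?thesis
    unfolding square_cost_def
    by (intro nn_integral_measurable_subprob_algebra2[where N=borel] \<kappa>) (simp add: split_beta)
qed

lemma measurable_density_prob_kernel:
  assumes \<rho>: "\<rho> \<in> Z \<rightarrow>\<^sub>M prob_algebra S" and f: "case_prod f \<in> borel_measurable (Z \<Otimes>\<^sub>M S)"
    and prob: "\<And>z. z \<in> space Z \<Longrightarrow> prob_space (density (\<rho> z) (f z))"
  shows "(\<lambda>z. density (\<rho> z) (f z)) \<in> Z \<rightarrow>\<^sub>M prob_algebra S"
proof (rule measurable_prob_algebraI)
  have \<rho>': "\<rho> \<in> Z \<rightarrow>\<^sub>M subprob_algebra S" using \<rho> by (rule measurable_prob_algebraD)
  show "(\<lambda>z. density (\<rho> z) (f z)) \<in> Z \<rightarrow>\<^sub>M subprob_algebra S"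
  proof (rule measurable_subprob_algebra)
    fix A assume A[measurable]: "A \<in> sets S"
    have "(\<lambda>z. \<integral>\<^sup>+ s. f z s * indicator A s \<partial>\<rho> z) \<in> borel_measurable Z"
      using f by (intro nn_integral_measurable_subprob_algebra2[OF _ \<rho>']) (simp add: split_beta)
    moreover have "emeasure (density (\<rho> z) (f z)) A = (\<integral>\<^sup>+ s. f z s * indicator A s \<partial>\<rho> z)"
      if z: "z \<in> space Z" for z
    proof (rule emeasure_density)
      show "f z \<in> borel_measurable (\<rho> z)"
        using measurable_compose_Pair1[OF z f] by (simp only: subprob_measurableD(3)[OF \<rho>' z] prod.case)
      show "A \<in> sets (\<rho> z)" using subprob_measurableD(2)[OF \<rho>' z] A by simp
    qed
    ultimately show "(\<lambda>z. emeasure (density (\<rho> z) (f z)) A) \<in> borel_measurable Z"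
      by (subst measurable_cong) auto
  qed (use prob subprob_measurableD(2)[OF \<rho>'] in \<open>auto intro: prob_space_imp_subprob_space\<close>)
qed (rule prob)

lemma INF_ennreal_approx:
  fixes f :: "'i \<Rightarrow> ennreal"
  assumes "\<delta> > 0"
  shows "\<exists>i. f i \<le> (INF j. f j) + \<delta>"
proof (rule ccontr)
  define m where "m = (INF j. f j)"
  assume "\<not> ?thesis"
  then have less: "m + \<delta> < f i" for i by (simp add: m_def not_le)
  then have "m + \<delta> \<le> m" unfolding m_def by (intro INF_greatest) (simp add: less_imp_le)
  moreover have "m \<noteq> \<infinity>" using less[of undefined] by auto
  ultimately show False
    using assms ennreal_add_left_cancel_le[of m \<delta> 0] by simp
qed

text \<open>The first index in the countable family whose cost is within \<open>\<delta>\<close> of the infimum depends measurably on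
  the parameter. Without
  second moments the countable family may miss the distance, but a measurable choice of couplings exists
  all the same; this matters because conditional laws have second moments only almost surely.\<close>

theorem measurable_near_optimal_coupling:
  fixes \<kappa> \<mu> :: "'z \<Rightarrow> 'a::{real_normed_vector, second_countable_topology} measure"
  assumes \<kappa>: "\<kappa> \<in> Z \<rightarrow>\<^sub>M prob_algebra borel" and \<mu>: "\<mu> \<in> Z \<rightarrow>\<^sub>M prob_algebra borel"
    and \<delta>: "\<delta> > 0"
  obtains \<gamma> where "\<gamma> \<in> Z \<rightarrow>\<^sub>M prob_algebra (borel \<Otimes>\<^sub>M borel)"
    "\<And>z. z \<in> space Z \<Longrightarrow> \<gamma> z \<in> couplings (\<kappa> z) (\<mu> z)"
    "\<And>z. z \<in> space Z \<Longrightarrow> second_moment (\<kappa> z) < \<infinity> \<Longrightarrow> second_moment (\<mu> z) < \<infinity> \<Longrightarrow>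
      (\<integral>\<^sup>+ p. ennreal ((dist (fst p) (snd p))\<^sup>2) \<partial>\<gamma> z) \<le> (wasserstein2 dist (\<kappa> z) (\<mu> z))\<^sup>2 + \<delta>"
proof -
  note \<kappa>' = measurable_prob_algebraD[OF \<kappa>] and \<mu>' = measurable_prob_algebraD[OF \<mu>]
  have pair: "borel_pair (\<kappa> z) (\<mu> z)" if "z \<in> space Z" for z
    using measurable_space[OF \<kappa> that] measurable_space[OF \<mu> that] by (rule borel_pairI)
  let ?c = "\<lambda>i z. square_cost (\<kappa> z) (\<mu> z) (grid_density i (\<kappa> z) (\<mu> z))"
  have c[measurable]: "?c i \<in> borel_measurable Z" for i
    using measurable_square_cost_kernel[OF \<kappa>' \<mu>' measurable_grid_density_kernel[OF \<kappa>' \<mu>']] .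
  define I where "I z = (LEAST i. ?c i z \<le> (INF j. ?c j z) + \<delta>)" for z
  have I[measurable]: "I \<in> Z \<rightarrow>\<^sub>M count_space UNIV"
    unfolding I_def by measurable
  have cI: "?c (I z) z \<le> (INF j. ?c j z) + \<delta>" for z
  proof -
    have "\<exists>i. ?c i z \<le> (INF j. ?c j z) + \<delta>" using \<delta> by (rule INF_ennreal_approx)
    then show ?thesis unfolding I_def by (rule LeastI_ex)
  qed
  define g where "g z = case_prod (grid_density (I z) (\<kappa> z) (\<mu> z))" for z
  define \<gamma> where "\<gamma> z = density (\<kappa> z \<Otimes>\<^sub>M \<mu> z) (g z)" for z
  have g: "case_prod g \<in> borel_measurable (Z \<Otimes>\<^sub>M borel \<Otimes>\<^sub>M borel)"
  proof -
    have "(\<lambda>w. (\<lambda>i. (\<lambda>(z, x, y). grid_density i (\<kappa> z) (\<mu> z) x y) w) (I (fst w)))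
        \<in> borel_measurable (Z \<Otimes>\<^sub>M borel \<Otimes>\<^sub>M borel)"
      by (rule measurable_compose_countable[OF measurable_grid_density_kernel[OF \<kappa>' \<mu>']]) measurable
    moreover have "case_prod g = (\<lambda>w. (\<lambda>i. (\<lambda>(z, x, y). grid_density i (\<kappa> z) (\<mu> z) x y) w) (I (fst w)))"
      by (simp add: fun_eq_iff g_def)
    ultimately show ?thesis by simp
  qed
  have coup: "\<gamma> z \<in> couplings (\<kappa> z) (\<mu> z)" if "z \<in> space Z" for z
  proof -
    interpret borel_pair "\<kappa> z" "\<mu> z" using pair[OF that] .
    show ?thesis unfolding \<gamma>_def g_def
      by (rule density_in_couplings[OF coupling_density_grid_density])
  qed
  show thesis
  proof
    show "\<gamma> \<in> Z \<rightarrow>\<^sub>M prob_algebra (borel \<Otimes>\<^sub>M borel)"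
      unfolding \<gamma>_def
    proof (rule measurable_density_prob_kernel)
      show "(\<lambda>z. \<kappa> z \<Otimes>\<^sub>M \<mu> z) \<in> Z \<rightarrow>\<^sub>M prob_algebra (borel \<Otimes>\<^sub>M borel)"
        using \<kappa> \<mu> by (rule measurable_pair_prob)
      show "case_prod g \<in> borel_measurable (Z \<Otimes>\<^sub>M borel \<Otimes>\<^sub>M borel)" by (rule g)
      show "prob_space (density (\<kappa> z \<Otimes>\<^sub>M \<mu> z) (g z))" if "z \<in> space Z" for z
        using couplings_prob_space[OF coup[OF that]] measurable_space[OF \<kappa> that]
        by (simp add: \<gamma>_def space_prob_algebra)
    qed
    show "\<gamma> z \<in> couplings (\<kappa> z) (\<mu> z)" if "z \<in> space Z" for z by (rule coup[OF that])
    fix z assume z: "z \<in> space Z" and fin: "second_moment (\<kappa> z) < \<infinity>" "second_moment (\<mu> z) < \<infinity>"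
    interpret borel_pair "\<kappa> z" "\<mu> z" using pair[OF z] .
    have "(\<integral>\<^sup>+ p. ennreal ((dist (fst p) (snd p))\<^sup>2) \<partial>\<gamma> z) = ?c (I z) z"
      unfolding \<gamma>_def g_def by (rule nn_integral_density_dist[OF coupling_density_grid_density])
    also have "\<dots> \<le> (wasserstein2 dist (\<kappa> z) (\<mu> z))\<^sup>2 + \<delta>"
      unfolding wasserstein2_eq_INF_grid_density[OF fin] by (rule cI)
    finally show "(\<integral>\<^sup>+ p. ennreal ((dist (fst p) (snd p))\<^sup>2) \<partial>\<gamma> z)
        \<le> (wasserstein2 dist (\<kappa> z) (\<mu> z))\<^sup>2 + \<delta>" .
  qed
qed

section \<open>The triangle inequality\<close>

text \<open>Under the density \<open>g x y * h y z\<close> with respect to \<open>M \<Otimes> N \<Otimes> L\<close>, the pairs \<open>(x, y)\<close> and \<open>(y, z)\<close> have the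
  two given couplings as laws; \<open>k\<close> is the density of \<open>(x, z)\<close>.\<close>

lemma glue_coupling_densities:
  fixes M N L :: "'a::{real_normed_vector, second_countable_topology} measure"
  assumes MN: "borel_pair M N" and NK: "borel_pair N L"
    and g: "coupling_density M N g" and h: "coupling_density N L h"
  defines "k \<equiv> \<lambda>x z. \<integral>\<^sup>+ y. g x y * h y z \<partial>N"
  shows "coupling_density M L k"
    and "square_cost M L k \<le> 2 * square_cost M N g + 2 * square_cost N L h"
proof -
  interpret MN: borel_pair M N by fact
  interpret NK: borel_pair N L by fact
  interpret MK: borel_pair M L by unfold_locales simp_all
  have [measurable]: "case_prod g \<in> borel_measurable (borel \<Otimes>\<^sub>M borel)"
      "case_prod h \<in> borel_measurable (borel \<Otimes>\<^sub>M borel)"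
    using g h by (auto simp: coupling_density_def cong: measurable_cong_sets)
  have g1: "AE x in M. (\<integral>\<^sup>+ y. g x y \<partial>N) = 1" and g2: "AE y in N. (\<integral>\<^sup>+ x. g x y \<partial>M) = 1"
    using g by (auto simp: coupling_density_def)
  have h1: "AE y in N. (\<integral>\<^sup>+ z. h y z \<partial>L) = 1" and h2: "AE z in L. (\<integral>\<^sup>+ y. h y z \<partial>N) = 1"
    using h by (auto simp: coupling_density_def)
  \<comment> \<open>Integrating out \<open>z\<close>, respectively \<open>x\<close>, removes one of the two densities.\<close>
  have left: "(\<integral>\<^sup>+ z. \<integral>\<^sup>+ y. u y * (g x y * h y z) \<partial>N \<partial>L) = (\<integral>\<^sup>+ y. u y * g x y \<partial>N)"
    if [measurable]: "u \<in> borel_measurable borel" for u x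
  proof -
    have "(\<integral>\<^sup>+ z. \<integral>\<^sup>+ y. u y * (g x y * h y z) \<partial>N \<partial>L) = (\<integral>\<^sup>+ y. \<integral>\<^sup>+ z. u y * (g x y * h y z) \<partial>L \<partial>N)"
      by (rule NK.Fubini') measurable
    also have "\<dots> = (\<integral>\<^sup>+ y. u y * g x y * (\<integral>\<^sup>+ z. h y z \<partial>L) \<partial>N)"
      by (intro nn_integral_cong) (simp add: nn_integral_cmult[symmetric] mult.assoc)
    also have "\<dots> = (\<integral>\<^sup>+ y. u y * g x y \<partial>N)"
      using h1 by (intro nn_integral_cong_AE) auto
    finally show ?thesis .
  qed
  have right: "(\<integral>\<^sup>+ x. \<integral>\<^sup>+ y. u y * (g x y * h y z) \<partial>N \<partial>M) = (\<integral>\<^sup>+ y. u y * h y z \<partial>N)"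
    if [measurable]: "u \<in> borel_measurable borel" for u z
  proof -
    have "(\<integral>\<^sup>+ x. \<integral>\<^sup>+ y. u y * (g x y * h y z) \<partial>N \<partial>M) = (\<integral>\<^sup>+ y. \<integral>\<^sup>+ x. u y * (g x y * h y z) \<partial>M \<partial>N)"
      by (rule MN.Fubini'[symmetric]) measurable
    also have "\<dots> = (\<integral>\<^sup>+ y. u y * h y z * (\<integral>\<^sup>+ x. g x y \<partial>M) \<partial>N)"
      by (intro nn_integral_cong) (simp add: nn_integral_cmult[symmetric] mult_ac)
    also have "\<dots> = (\<integral>\<^sup>+ y. u y * h y z \<partial>N)"
      using g2 by (intro nn_integral_cong_AE) auto
    finally show ?thesis .
  qed
  show "coupling_density M L k"
    unfolding coupling_density_def
  proof (intro conjI)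
    show "case_prod k \<in> borel_measurable (M \<Otimes>\<^sub>M L)" unfolding k_def by measurable
    show "AE x in M. (\<integral>\<^sup>+ z. k x z \<partial>L) = 1"
      unfolding k_def using g1 left[of "\<lambda>_. 1"] by simp
    show "AE z in L. (\<integral>\<^sup>+ x. k x z \<partial>M) = 1"
      unfolding k_def using h2 right[of "\<lambda>_. 1"] by simp
  qed
  have "square_cost M L k = (\<integral>\<^sup>+ x. \<integral>\<^sup>+ z. \<integral>\<^sup>+ y. ennreal ((dist x z)\<^sup>2) * (g x y * h y z) \<partial>N \<partial>L \<partial>M)"
    unfolding square_cost_def k_def by (simp add: nn_integral_cmult)
  also have "\<dots> \<le> (\<integral>\<^sup>+ x. \<integral>\<^sup>+ z. \<integral>\<^sup>+ y. 2 * ennreal ((dist x y)\<^sup>2) * (g x y * h y z)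
      + 2 * ennreal ((dist y z)\<^sup>2) * (g x y * h y z) \<partial>N \<partial>L \<partial>M)"
    unfolding distrib_right[symmetric]
    by (intro nn_integral_mono mult_right_mono square_dist_triangle) auto
  also have "\<dots> = (\<integral>\<^sup>+ x. \<integral>\<^sup>+ z. \<integral>\<^sup>+ y. 2 * ennreal ((dist x y)\<^sup>2) * (g x y * h y z) \<partial>N \<partial>L \<partial>M)
      + (\<integral>\<^sup>+ x. \<integral>\<^sup>+ z. \<integral>\<^sup>+ y. 2 * ennreal ((dist y z)\<^sup>2) * (g x y * h y z) \<partial>N \<partial>L \<partial>M)"
    by (simp add: nn_integral_add)
  also have "(\<integral>\<^sup>+ x. \<integral>\<^sup>+ z. \<integral>\<^sup>+ y. 2 * ennreal ((dist x y)\<^sup>2) * (g x y * h y z) \<partial>N \<partial>L \<partial>M)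
      = 2 * square_cost M N g"
    unfolding square_cost_def by (subst left) (simp_all add: mult.assoc nn_integral_cmult)
  also have "(\<integral>\<^sup>+ x. \<integral>\<^sup>+ z. \<integral>\<^sup>+ y. 2 * ennreal ((dist y z)\<^sup>2) * (g x y * h y z) \<partial>N \<partial>L \<partial>M)
      = (\<integral>\<^sup>+ z. \<integral>\<^sup>+ x. \<integral>\<^sup>+ y. 2 * ennreal ((dist y z)\<^sup>2) * (g x y * h y z) \<partial>N \<partial>M \<partial>L)"
    by (rule MK.Fubini'[symmetric]) measurable
  also have "\<dots> = (\<integral>\<^sup>+ z. \<integral>\<^sup>+ y. 2 * ennreal ((dist y z)\<^sup>2) * h y z \<partial>N \<partial>L)"
    by (subst right) simp_all
  also have "\<dots> = (\<integral>\<^sup>+ y. \<integral>\<^sup>+ z. 2 * ennreal ((dist y z)\<^sup>2) * h y z \<partial>L \<partial>N)"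
    by (rule NK.Fubini') measurable
  also have "\<dots> = 2 * square_cost N L h"
    unfolding square_cost_def by (simp add: mult.assoc nn_integral_cmult)
  finally show "square_cost M L k \<le> 2 * square_cost M N g + 2 * square_cost N L h" .
qed

text \<open>The squared form of the triangle inequality with the constant \<open>2\<close> of the final estimate. Finite second
  moments reduce it to couplings with densities, which can be glued.\<close>

theorem wasserstein2_triangle:
  fixes M N L :: "'a::{real_normed_vector, second_countable_topology} measure"
  assumes M: "M \<in> space (prob_algebra borel)" "second_moment M < \<infinity>"
    and N: "N \<in> space (prob_algebra borel)" "second_moment N < \<infinity>"
    and L: "L \<in> space (prob_algebra borel)" "second_moment L < \<infinity>"
  shows "(wasserstein2 dist M L)\<^sup>2 \<le> 2 * (wasserstein2 dist M N)\<^sup>2 + 2 * (wasserstein2 dist N L)\<^sup>2"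
proof -
  note MN = borel_pairI[OF M(1) N(1)] and NK = borel_pairI[OF N(1) L(1)] and MK = borel_pairI[OF M(1) L(1)]
  have "(wasserstein2 dist M L)\<^sup>2
      \<le> 2 * square_cost M N (grid_density i M N) + 2 * square_cost N L (grid_density j N L)" for i j
  proof -
    note glue = glue_coupling_densities[OF MN NK borel_pair.coupling_density_grid_density[OF MN]
        borel_pair.coupling_density_grid_density[OF NK], of i j]
    from borel_pair.wasserstein2_le_density[OF MK glue(1)] glue(2) show ?thesis by (rule order_trans)
  qed
  then have "(wasserstein2 dist M L)\<^sup>2 \<le> (INF i. INF j.
      2 * square_cost M N (grid_density i M N) + 2 * square_cost N L (grid_density j N L))"
    by (intro INF_greatest)
  also have "\<dots> = 2 * (INF i. square_cost M N (grid_density i M N))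
      + 2 * (INF j. square_cost N L (grid_density j N L))"
    by (simp add: INF_ennreal_add_const INF_ennreal_const_add INF_ennreal_cmult)
  finally show ?thesis
    unfolding borel_pair.wasserstein2_eq_INF_grid_density[OF MN M(2) N(2)]
      borel_pair.wasserstein2_eq_INF_grid_density[OF NK N(2) L(2)] .
qed

section \<open>Paths and kernel products\<close>

lemma path_dist_square: "(path_dist i x y)\<^sup>2 = (\<Sum>j\<le>i. (dist (x j) (y j))\<^sup>2)"
  by (simp add: path_dist_def path_norm_def L2_set_def sum_nonneg dist_norm)

lemma path_norm_square: "(path_norm i x)\<^sup>2 = (\<Sum>j\<le>i. (norm (x j))\<^sup>2)"
  by (simp add: path_norm_def L2_set_def sum_nonneg)

lemma path_norm_square_le:
  "ennreal ((path_norm i y)\<^sup>2) \<le> 2 * ennreal ((path_norm i x)\<^sup>2) + 2 * ennreal ((path_dist i x y)\<^sup>2)"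
proof -
  have "(norm (y j))\<^sup>2 \<le> 2 * (norm (x j))\<^sup>2 + 2 * (dist (x j) (y j))\<^sup>2" for j
  proof -
    have "(norm (y j))\<^sup>2 \<le> (norm (x j) + dist (x j) (y j))\<^sup>2"
      using norm_triangle_sub[of "y j" "x j"] by (intro power_mono) (auto simp: dist_norm norm_minus_commute)
    also have "\<dots> \<le> 2 * (norm (x j))\<^sup>2 + 2 * (dist (x j) (y j))\<^sup>2"
      using sum_squares_ge_zero[of "norm (x j) - dist (x j) (y j)" 0] by (simp add: power2_eq_square algebra_simps)
    finally show ?thesis .
  qed
  then have "(path_norm i y)\<^sup>2 \<le> 2 * (path_norm i x)\<^sup>2 + 2 * (path_dist i x y)\<^sup>2"
    unfolding path_norm_square path_dist_square sum_distrib_left sum.distrib[symmetric] by (intro sum_mono)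
  then show ?thesis
    by (simp add: ennreal_leI ennreal_mult[symmetric] ennreal_plus[symmetric] del: ennreal_plus flip: ennreal_numeral)
qed

lemma path_dist_square_upd:
  "(path_dist (Suc i) (x(Suc i := a)) (y(Suc i := b)))\<^sup>2 = (path_dist i x y)\<^sup>2 + (dist a b)\<^sup>2"
  by (simp add: path_dist_square)

lemma measurable_path_dist_square[measurable]:
  "(\<lambda>z. (path_dist i (fst z) (snd z))\<^sup>2) \<in> borel_measurable (path_space i \<Otimes>\<^sub>M path_space i)"
  unfolding path_dist_square by (intro borel_measurable_sum) measurable

lemma measurable_path_norm_square[measurable]:
  "(\<lambda>x. (path_norm i x)\<^sup>2) \<in> borel_measurable (path_space i)"
  unfolding path_norm_square by (intro borel_measurable_sum) measurable

lemma measurable_path_upd: "(\<lambda>(x, y). x(Suc i := y)) \<in> path_space i \<Otimes>\<^sub>M borel \<rightarrow>\<^sub>M path_space (Suc i)"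
  unfolding split_beta by (rule measurable_fun_upd[where J="{..i}"]) auto

lemma kernel_prod_in_prob_algebra:
  assumes \<nu>: "\<nu> \<in> space (prob_algebra (path_space i))" and \<kappa>: "path_kernel i \<kappa>"
  shows "kernel_prod i \<nu> \<kappa> \<in> space (prob_algebra (path_space (Suc i)))"
proof -
  have K: "(\<lambda>x. distr (\<kappa> x) (path_space (Suc i)) (\<lambda>y. x(Suc i := y)))
      \<in> path_space i \<rightarrow>\<^sub>M prob_algebra (path_space (Suc i))"
    by (rule measurable_distr_prob_space2[OF \<kappa> measurable_path_upd])
  show ?thesis
    unfolding kernel_prod_def using prob_space_bind'[OF \<nu> K] sets_bind'[OF \<nu> K]
    by (simp add: space_prob_algebra)
qed

lemma measurable_kernel_section:
  assumes \<kappa>: "path_kernel i \<kappa>" and f: "f \<in> borel_measurable (path_space (Suc i))"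
    and a: "a \<in> space (path_space i)"
  shows "(\<lambda>y. f (a(Suc i := y))) \<in> borel_measurable (\<kappa> a)"
  using measurable_compose[OF measurable_compose_Pair1[OF a measurable_path_upd] f]
  by (simp only: prod.case subprob_measurableD(3)[OF measurable_prob_algebraD[OF \<kappa>] a])

lemma measurable_kernel_integral:
  assumes \<kappa>: "path_kernel i \<kappa>" and f: "f \<in> borel_measurable (path_space (Suc i))"
  shows "(\<lambda>a. \<integral>\<^sup>+ y. f (a(Suc i := y)) \<partial>\<kappa> a) \<in> borel_measurable (path_space i)"
  using measurable_compose[OF measurable_path_upd f]
  by (intro nn_integral_measurable_subprob_algebra2[OF _ measurable_prob_algebraD[OF \<kappa>]])
    (simp add: split_beta)

lemma distr_eq_kernel_prodI:
  fixes \<nu> :: "(nat \<Rightarrow> 'a::euclidean_space) measure"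
  assumes \<nu>: "\<nu> \<in> space (prob_algebra (path_space i))" and \<kappa>: "path_kernel i \<kappa>"
    and g: "g \<in> \<rho> \<rightarrow>\<^sub>M path_space (Suc i)"
    and eq: "\<And>f. f \<in> borel_measurable (path_space (Suc i)) \<Longrightarrow>
      (\<integral>\<^sup>+ w. f (g w) \<partial>\<rho>) = (\<integral>\<^sup>+ a. \<integral>\<^sup>+ y. f (a(Suc i := y)) \<partial>\<kappa> a \<partial>\<nu>)"
  shows "distr \<rho> (kernel_prod i \<nu> \<kappa>) g = kernel_prod i \<nu> \<kappa>"
proof (rule measure_eqI)
  have sets: "sets (kernel_prod i \<nu> \<kappa>) = sets (path_space (Suc i))"
    using kernel_prod_in_prob_algebra[OF \<nu> \<kappa>] by (simp add: space_prob_algebra)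
  fix A assume "A \<in> sets (distr \<rho> (kernel_prod i \<nu> \<kappa>) g)"
  then have A: "A \<in> sets (path_space (Suc i))" by (simp add: sets)
  have "emeasure (distr \<rho> (kernel_prod i \<nu> \<kappa>) g) A = (\<integral>\<^sup>+ w. indicator A (g w) \<partial>\<rho>)"
    using g A by (subst nn_integral_indicator[symmetric], simp add: sets, subst nn_integral_distr)
      (simp_all add: sets cong: measurable_cong_sets)
  also have "\<dots> = (\<integral>\<^sup>+ x. indicator A x \<partial>kernel_prod i \<nu> \<kappa>)"
    using A \<nu> by (subst nn_integral_kernel_prod[OF _ \<kappa>]) (auto simp: space_prob_algebra eq)
  finally show "emeasure (distr \<rho> (kernel_prod i \<nu> \<kappa>) g) A = emeasure (kernel_prod i \<nu> \<kappa>) A"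
    using A by (simp add: sets)
qed simp

text \<open>Extending a coupling of the past by a kernel of couplings of the next coordinates couples the extended
  laws. The integral formula determines the extension and gives its cost.\<close>

lemma coupling_kernel_prod:
  fixes P Q :: "(nat \<Rightarrow> 'a::euclidean_space) measure"
  assumes P: "P \<in> space (prob_algebra (path_space i))" and Q: "Q \<in> space (prob_algebra (path_space i))"
    and \<kappa>: "path_kernel i \<kappa>" and \<mu>: "path_kernel i \<mu>" and \<pi>: "\<pi> \<in> couplings P Q"
    and \<gamma>: "\<gamma> \<in> path_space i \<Otimes>\<^sub>M path_space i \<rightarrow>\<^sub>M prob_algebra (borel \<Otimes>\<^sub>M borel)"
    and \<gamma>_coupling: "\<And>z. z \<in> space (path_space i \<Otimes>\<^sub>M path_space i) \<Longrightarrow> \<gamma> z \<in> couplings (\<kappa> (fst z)) (\<mu> (snd z))"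
  obtains \<pi>' where "\<pi>' \<in> couplings (kernel_prod i P \<kappa>) (kernel_prod i Q \<mu>)"
    "\<And>f. f \<in> borel_measurable (path_space (Suc i) \<Otimes>\<^sub>M path_space (Suc i)) \<Longrightarrow>
      (\<integral>\<^sup>+ w. f w \<partial>\<pi>') = (\<integral>\<^sup>+ z. \<integral>\<^sup>+ p. f ((fst z)(Suc i := fst p), (snd z)(Suc i := snd p)) \<partial>\<gamma> z \<partial>\<pi>)"
proof -
  let ?S = "path_space i :: (nat \<Rightarrow> 'a) measure" and ?S' = "path_space (Suc i) :: (nat \<Rightarrow> 'a) measure"
  have setsP[measurable_cong]: "sets P = sets ?S" and setsQ[measurable_cong]: "sets Q = sets ?S"
    using P Q by (auto simp: space_prob_algebra)
  have sets\<pi>[measurable_cong]: "sets \<pi> = sets (?S \<Otimes>\<^sub>M ?S)"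
    using \<pi> setsP setsQ by (simp add: couplings_def cong: sets_pair_measure_cong)
  have prob\<pi>: "prob_space \<pi>" using couplings_prob_space[OF \<pi>] P by (simp add: space_prob_algebra)
  have \<pi>': "\<pi> \<in> space (prob_algebra (?S \<Otimes>\<^sub>M ?S))" using prob\<pi> sets\<pi> by (simp add: space_prob_algebra)
  define G where "G z = distr (\<gamma> z) (?S' \<Otimes>\<^sub>M ?S') (\<lambda>p. ((fst z)(Suc i := fst p), (snd z)(Suc i := snd p)))" for z
  have upd: "(\<lambda>(z, p). ((fst z)(Suc i := fst p), (snd z)(Suc i := snd p)))
      \<in> (?S \<Otimes>\<^sub>M ?S) \<Otimes>\<^sub>M (borel \<Otimes>\<^sub>M borel) \<rightarrow>\<^sub>M ?S' \<Otimes>\<^sub>M ?S'"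
  proof -
    have "(\<lambda>w. (fst (fst w))(Suc i := fst (snd w))) \<in> (?S \<Otimes>\<^sub>M ?S) \<Otimes>\<^sub>M (borel \<Otimes>\<^sub>M borel) \<rightarrow>\<^sub>M ?S'"
      "(\<lambda>w. (snd (fst w))(Suc i := snd (snd w))) \<in> (?S \<Otimes>\<^sub>M ?S) \<Otimes>\<^sub>M (borel \<Otimes>\<^sub>M borel) \<rightarrow>\<^sub>M ?S'"
      by (rule measurable_fun_upd[where J="{..i}"], auto)+
    then show ?thesis unfolding split_beta by (rule measurable_Pair)
  qed
  have G: "G \<in> ?S \<Otimes>\<^sub>M ?S \<rightarrow>\<^sub>M prob_algebra (?S' \<Otimes>\<^sub>M ?S')"
    unfolding G_def by (rule measurable_distr_prob_space2[OF \<gamma> upd])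
  define \<rho> where "\<rho> = \<pi> \<bind> G"
  have sets\<rho>[measurable_cong]: "sets \<rho> = sets (?S' \<Otimes>\<^sub>M ?S')"
    unfolding \<rho>_def by (rule sets_bind'[OF \<pi>' G])
  have int\<rho>: "(\<integral>\<^sup>+ w. f w \<partial>\<rho>)
      = (\<integral>\<^sup>+ z. \<integral>\<^sup>+ p. f ((fst z)(Suc i := fst p), (snd z)(Suc i := snd p)) \<partial>\<gamma> z \<partial>\<pi>)"
    if f: "f \<in> borel_measurable (?S' \<Otimes>\<^sub>M ?S')" for f
  proof -
    have "G \<in> \<pi> \<rightarrow>\<^sub>M subprob_algebra (?S' \<Otimes>\<^sub>M ?S')"
      using measurable_prob_algebraD[OF G] by (simp cong: measurable_cong_sets add: sets\<pi>)
    then have "(\<integral>\<^sup>+ w. f w \<partial>\<rho>) = (\<integral>\<^sup>+ z. \<integral>\<^sup>+ w. f w \<partial>G z \<partial>\<pi>)"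
      unfolding \<rho>_def by (rule nn_integral_bind[OF f])
    also have "\<dots> = (\<integral>\<^sup>+ z. \<integral>\<^sup>+ p. f ((fst z)(Suc i := fst p), (snd z)(Suc i := snd p)) \<partial>\<gamma> z \<partial>\<pi>)"
    proof (rule nn_integral_cong)
      fix z assume "z \<in> space \<pi>"
      then have z: "z \<in> space (?S \<Otimes>\<^sub>M ?S)" using sets_eq_imp_space_eq[OF sets\<pi>] by simp
      have "(\<lambda>p. ((fst z)(Suc i := fst p), (snd z)(Suc i := snd p))) \<in> \<gamma> z \<rightarrow>\<^sub>M ?S' \<Otimes>\<^sub>M ?S'"
        using measurable_compose_Pair1[OF z upd]
        by (simp only: prod.case subprob_measurableD(3)[OF measurable_prob_algebraD[OF \<gamma>] z])
      then show "(\<integral>\<^sup>+ w. f w \<partial>G z) = (\<integral>\<^sup>+ p. f ((fst z)(Suc i := fst p), (snd z)(Suc i := snd p)) \<partial>\<gamma> z)"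
        unfolding G_def using f by (subst nn_integral_distr) simp_all
    qed
    finally show ?thesis .
  qed
  have setsK: "sets (kernel_prod i P \<kappa>) = sets ?S'" "sets (kernel_prod i Q \<mu>) = sets ?S'"
    using kernel_prod_in_prob_algebra[OF P \<kappa>] kernel_prod_in_prob_algebra[OF Q \<mu>]
    by (auto simp: space_prob_algebra)
  have fst_marginal: "distr \<rho> (kernel_prod i P \<kappa>) fst = kernel_prod i P \<kappa>"
  proof (rule distr_eq_kernel_prodI[OF P \<kappa>])
    show "fst \<in> \<rho> \<rightarrow>\<^sub>M ?S'" by measurable
    fix f :: "(nat \<Rightarrow> 'a) \<Rightarrow> ennreal" assume f[measurable]: "f \<in> borel_measurable ?S'"
    have "(\<integral>\<^sup>+ w. f (fst w) \<partial>\<rho>) = (\<integral>\<^sup>+ z. \<integral>\<^sup>+ p. f ((fst z)(Suc i := fst p)) \<partial>\<gamma> z \<partial>\<pi>)"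
      by (subst int\<rho>) simp_all
    also have "\<dots> = (\<integral>\<^sup>+ z. \<integral>\<^sup>+ y. f ((fst z)(Suc i := y)) \<partial>\<kappa> (fst z) \<partial>\<pi>)"
    proof (rule nn_integral_cong)
      fix z assume "z \<in> space \<pi>"
      then have z: "z \<in> space (?S \<Otimes>\<^sub>M ?S)" using sets_eq_imp_space_eq[OF sets\<pi>] by simp
      then have "fst z \<in> space ?S" by (auto simp: space_pair_measure)
      from nn_integral_couplings(1)[OF \<gamma>_coupling[OF z] measurable_kernel_section[OF \<kappa> f this]]
      show "(\<integral>\<^sup>+ p. f ((fst z)(Suc i := fst p)) \<partial>\<gamma> z) = (\<integral>\<^sup>+ y. f ((fst z)(Suc i := y)) \<partial>\<kappa> (fst z))" .
    qed
    also have "\<dots> = (\<integral>\<^sup>+ a. \<integral>\<^sup>+ y. f (a(Suc i := y)) \<partial>\<kappa> a \<partial>P)"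
      using measurable_kernel_integral[OF \<kappa> f]
      by (intro nn_integral_couplings(1)[OF \<pi>]) (simp only: measurable_cong_sets[OF setsP refl])
    finally show "(\<integral>\<^sup>+ w. f (fst w) \<partial>\<rho>) = (\<integral>\<^sup>+ a. \<integral>\<^sup>+ y. f (a(Suc i := y)) \<partial>\<kappa> a \<partial>P)" .
  qed
  have snd_marginal: "distr \<rho> (kernel_prod i Q \<mu>) snd = kernel_prod i Q \<mu>"
  proof (rule distr_eq_kernel_prodI[OF Q \<mu>])
    show "snd \<in> \<rho> \<rightarrow>\<^sub>M ?S'" by measurable
    fix f :: "(nat \<Rightarrow> 'a) \<Rightarrow> ennreal" assume f[measurable]: "f \<in> borel_measurable ?S'"
    have "(\<integral>\<^sup>+ w. f (snd w) \<partial>\<rho>) = (\<integral>\<^sup>+ z. \<integral>\<^sup>+ p. f ((snd z)(Suc i := snd p)) \<partial>\<gamma> z \<partial>\<pi>)"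
      by (subst int\<rho>) simp_all
    also have "\<dots> = (\<integral>\<^sup>+ z. \<integral>\<^sup>+ y. f ((snd z)(Suc i := y)) \<partial>\<mu> (snd z) \<partial>\<pi>)"
    proof (rule nn_integral_cong)
      fix z assume "z \<in> space \<pi>"
      then have z: "z \<in> space (?S \<Otimes>\<^sub>M ?S)" using sets_eq_imp_space_eq[OF sets\<pi>] by simp
      then have "snd z \<in> space ?S" by (auto simp: space_pair_measure)
      from nn_integral_couplings(2)[OF \<gamma>_coupling[OF z] measurable_kernel_section[OF \<mu> f this]]
      show "(\<integral>\<^sup>+ p. f ((snd z)(Suc i := snd p)) \<partial>\<gamma> z) = (\<integral>\<^sup>+ y. f ((snd z)(Suc i := y)) \<partial>\<mu> (snd z))" .
    qed
    also have "\<dots> = (\<integral>\<^sup>+ a. \<integral>\<^sup>+ y. f (a(Suc i := y)) \<partial>\<mu> a \<partial>Q)"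
      using measurable_kernel_integral[OF \<mu> f]
      by (intro nn_integral_couplings(2)[OF \<pi>]) (simp only: measurable_cong_sets[OF setsQ refl])
    finally show "(\<integral>\<^sup>+ w. f (snd w) \<partial>\<rho>) = (\<integral>\<^sup>+ a. \<integral>\<^sup>+ y. f (a(Suc i := y)) \<partial>\<mu> a \<partial>Q)" .
  qed
  show thesis
  proof
    show "\<rho> \<in> couplings (kernel_prod i P \<kappa>) (kernel_prod i Q \<mu>)"
      using fst_marginal snd_marginal sets\<rho> setsK
      by (simp add: couplings_def cong: sets_pair_measure_cong)
  qed (rule int\<rho>)
qed

text \<open>The recursion step. The moment hypothesis on \<open>\<kappa>\<close> can only be expected almost everywhere; the one on \<open>\<mu>\<close>
  is imposed at every point, because \<open>\<mu>\<close> is evaluated at both coordinates of the coupling and \<open>P\<close> and \<open>Q\<close>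
  may have different null sets.\<close>

lemma wasserstein2_kernel_prod_le:
  fixes P Q :: "(nat \<Rightarrow> 'a::euclidean_space) measure"
  assumes P: "P \<in> space (prob_algebra (path_space i))" and Q: "Q \<in> space (prob_algebra (path_space i))"
    and \<kappa>: "path_kernel i \<kappa>" and \<mu>: "path_kernel i \<mu>"
    and \<kappa>_moment: "AE a in P. second_moment (\<kappa> a) < \<infinity>"
    and \<mu>_moment: "\<And>a. a \<in> space (path_space i) \<Longrightarrow> second_moment (\<mu> a) < \<infinity>"
    and close: "(\<integral>\<^sup>+ a. (wasserstein2 dist (\<kappa> a) (\<mu> a))\<^sup>2 \<partial>P) \<le> ennreal \<epsilon>"
    and lipschitz: "\<And>a b. a \<in> space (path_space i) \<Longrightarrow> b \<in> space (path_space i) \<Longrightarrow>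
      wasserstein2 dist (\<mu> a) (\<mu> b) \<le> ennreal (K * path_dist i a b)"
    and "\<epsilon> \<ge> 0" "K \<ge> 0"
  shows "(wasserstein2 (path_dist (Suc i)) (kernel_prod i P \<kappa>) (kernel_prod i Q \<mu>))\<^sup>2
    \<le> ennreal (2 * \<epsilon>) + ennreal (1 + 2 * K\<^sup>2) * (wasserstein2 (path_dist i) P Q)\<^sup>2"
proof (rule le_add_cmult_wasserstein2)
  let ?S = "path_space i :: (nat \<Rightarrow> 'a) measure"
  fix \<pi> assume \<pi>: "\<pi> \<in> couplings P Q"
  have setsP[measurable_cong]: "sets P = sets ?S" and setsQ[measurable_cong]: "sets Q = sets ?S"
    using P Q by (auto simp: space_prob_algebra)
  have sets\<pi>[measurable_cong]: "sets \<pi> = sets (?S \<Otimes>\<^sub>M ?S)"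
    using \<pi> setsP setsQ by (simp add: couplings_def cong: sets_pair_measure_cong)
  interpret prob_space \<pi> using couplings_prob_space[OF \<pi>] P by (simp add: space_prob_algebra)
  note space\<pi> = sets_eq_imp_space_eq[OF sets\<pi>] and spaceP = sets_eq_imp_space_eq[OF setsP]
  let ?D = "\<lambda>z. ennreal ((path_dist i (fst z) (snd z))\<^sup>2)"
  \<comment> \<open>A measurable version of the squared distance of the two kernels.\<close>
  define v where "v a = (INF j. square_cost (\<kappa> a) (\<mu> a) (grid_density j (\<kappa> a) (\<mu> a)))" for a
  note \<kappa>' = measurable_prob_algebraD[OF \<kappa>] and \<mu>' = measurable_prob_algebraD[OF \<mu>]
  have v: "v \<in> borel_measurable ?S"
    unfolding v_def
    by (intro borel_measurable_INF measurable_square_cost_kernel[OF \<kappa>' \<mu>' measurable_grid_density_kernel[OF \<kappa>' \<mu>']]) simp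
  have vP[measurable]: "v \<in> borel_measurable P" using v by (simp only: measurable_cong_sets[OF setsP refl])
  have v\<pi>[measurable]: "(\<lambda>z. v (fst z)) \<in> borel_measurable \<pi>"
    using measurable_compose[OF measurable_fst v] by (simp only: measurable_cong_sets[OF sets\<pi> refl])
  have D[measurable]: "?D \<in> borel_measurable \<pi>"
    by (simp only: measurable_cong_sets[OF sets\<pi> refl]) measurable
  have v_eq: "v a = (wasserstein2 dist (\<kappa> a) (\<mu> a))\<^sup>2"
    if "a \<in> space ?S" "second_moment (\<kappa> a) < \<infinity>" for a
    unfolding v_def using that \<mu>_moment measurable_space[OF \<kappa>] measurable_space[OF \<mu>]
    by (intro borel_pair.wasserstein2_eq_INF_grid_density[symmetric] borel_pairI) auto
  have "(\<integral>\<^sup>+ a. v a \<partial>P) = (\<integral>\<^sup>+ a. (wasserstein2 dist (\<kappa> a) (\<mu> a))\<^sup>2 \<partial>P)"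
  proof (rule nn_integral_cong_AE)
    show "AE a in P. v a = (wasserstein2 dist (\<kappa> a) (\<mu> a))\<^sup>2"
      using \<kappa>_moment AE_space by eventually_elim (simp add: v_eq spaceP)
  qed
  with close have v_le: "(\<integral>\<^sup>+ a. v a \<partial>P) \<le> ennreal \<epsilon>" by simp
  have AE\<pi>: "AE z in \<pi>. second_moment (\<kappa> (fst z)) < \<infinity>"
  proof (rule AE_distrD[where P="\<lambda>a. second_moment (\<kappa> a) < \<infinity>"])
    show "fst \<in> \<pi> \<rightarrow>\<^sub>M P" by measurable
    have "distr \<pi> P fst = P" using \<pi> by (simp add: couplings_def)
    then show "AE a in distr \<pi> P fst. second_moment (\<kappa> a) < \<infinity>"
      by (simp only: \<kappa>_moment)
  qed
  show "(wasserstein2 (path_dist (Suc i)) (kernel_prod i P \<kappa>) (kernel_prod i Q \<mu>))\<^sup>2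
    \<le> ennreal (2 * \<epsilon>) + ennreal (1 + 2 * K\<^sup>2) * (\<integral>\<^sup>+ z. ?D z \<partial>\<pi>)"
  \<comment> \<open>The slack \<open>\<delta>\<close> pays for the near-optimal choice of the coupling.\<close>
  proof (rule ennreal_le_epsilon)
    fix \<delta> :: real assume \<delta>: "\<delta> > 0"
    obtain \<gamma> where \<gamma>: "\<gamma> \<in> ?S \<Otimes>\<^sub>M ?S \<rightarrow>\<^sub>M prob_algebra (borel \<Otimes>\<^sub>M borel)"
      and \<gamma>_coupling: "\<And>z. z \<in> space (?S \<Otimes>\<^sub>M ?S) \<Longrightarrow> \<gamma> z \<in> couplings (\<kappa> (fst z)) (\<mu> (snd z))"
      and \<gamma>_cost: "\<And>z. z \<in> space (?S \<Otimes>\<^sub>M ?S) \<Longrightarrow> second_moment (\<kappa> (fst z)) < \<infinity> \<Longrightarrow>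
        second_moment (\<mu> (snd z)) < \<infinity> \<Longrightarrow> (\<integral>\<^sup>+ p. ennreal ((dist (fst p) (snd p))\<^sup>2) \<partial>\<gamma> z)
          \<le> (wasserstein2 dist (\<kappa> (fst z)) (\<mu> (snd z)))\<^sup>2 + ennreal \<delta>"
      by (rule measurable_near_optimal_coupling[where \<delta>="ennreal \<delta>",
            OF measurable_compose[OF measurable_fst \<kappa>] measurable_compose[OF measurable_snd \<mu>]]) (use \<delta> in auto)
    obtain \<pi>' where \<pi>': "\<pi>' \<in> couplings (kernel_prod i P \<kappa>) (kernel_prod i Q \<mu>)"
      and int\<pi>': "\<And>f. f \<in> borel_measurable (path_space (Suc i) \<Otimes>\<^sub>M path_space (Suc i)) \<Longrightarrow>
      (\<integral>\<^sup>+ w. f w \<partial>\<pi>') = (\<integral>\<^sup>+ z. \<integral>\<^sup>+ p. f ((fst z)(Suc i := fst p), (snd z)(Suc i := snd p)) \<partial>\<gamma> z \<partial>\<pi>)"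
      using coupling_kernel_prod[OF P Q \<kappa> \<mu> \<pi> \<gamma> \<gamma>_coupling] by blast
    have cost: "(\<integral>\<^sup>+ p. ennreal ((dist (fst p) (snd p))\<^sup>2) \<partial>\<gamma> z)
        \<le> 2 * v (fst z) + ennreal (2 * K\<^sup>2) * ?D z + ennreal \<delta>"
      if z: "z \<in> space (?S \<Otimes>\<^sub>M ?S)" and fin: "second_moment (\<kappa> (fst z)) < \<infinity>" for z
    proof -
      have ab: "fst z \<in> space ?S" "snd z \<in> space ?S" using z by (auto simp: space_pair_measure)
      have "(wasserstein2 dist (\<kappa> (fst z)) (\<mu> (snd z)))\<^sup>2
          \<le> 2 * (wasserstein2 dist (\<kappa> (fst z)) (\<mu> (fst z)))\<^sup>2 + 2 * (wasserstein2 dist (\<mu> (fst z)) (\<mu> (snd z)))\<^sup>2"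
        using ab fin \<mu>_moment measurable_space[OF \<kappa>] measurable_space[OF \<mu>]
        by (intro wasserstein2_triangle) auto
      also have "(wasserstein2 dist (\<mu> (fst z)) (\<mu> (snd z)))\<^sup>2 \<le> (ennreal (K * path_dist i (fst z) (snd z)))\<^sup>2"
        by (intro power_mono lipschitz ab) simp
      also have "(ennreal (K * path_dist i (fst z) (snd z)))\<^sup>2 = ennreal (K\<^sup>2) * ?D z"
      proof -
        have "path_dist i (fst z) (snd z) \<ge> 0" by (simp add: path_dist_def path_norm_def)
        then show ?thesis
          using \<open>K \<ge> 0\<close> by (simp add: ennreal_power power_mult_distrib ennreal_mult)
      qed
      also have "2 * (ennreal (K\<^sup>2) * ?D z) = ennreal (2 * K\<^sup>2) * ?D z"
        by (simp add: ennreal_mult mult.assoc)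
      finally have "(wasserstein2 dist (\<kappa> (fst z)) (\<mu> (snd z)))\<^sup>2 \<le> 2 * v (fst z) + ennreal (2 * K\<^sup>2) * ?D z"
        using v_eq[OF ab(1) fin] by (simp add: add_left_mono mult_left_mono)
      then have "(wasserstein2 dist (\<kappa> (fst z)) (\<mu> (snd z)))\<^sup>2 + ennreal \<delta>
          \<le> 2 * v (fst z) + ennreal (2 * K\<^sup>2) * ?D z + ennreal \<delta>"
        by (rule add_right_mono)
      with \<gamma>_cost[OF z fin \<mu>_moment[OF ab(2)]] show ?thesis by (rule order_trans)
    qed
    have "(wasserstein2 (path_dist (Suc i)) (kernel_prod i P \<kappa>) (kernel_prod i Q \<mu>))\<^sup>2
        \<le> (\<integral>\<^sup>+ w. ennreal ((path_dist (Suc i) (fst w) (snd w))\<^sup>2) \<partial>\<pi>')"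
      by (rule wasserstein2_le_coupling[OF \<pi>'])
    also have "\<dots> = (\<integral>\<^sup>+ z. \<integral>\<^sup>+ p. ?D z + ennreal ((dist (fst p) (snd p))\<^sup>2) \<partial>\<gamma> z \<partial>\<pi>)"
      by (subst int\<pi>') (simp_all add: path_dist_square_upd ennreal_plus)
    also have "\<dots> \<le> (\<integral>\<^sup>+ z. ?D z + (2 * v (fst z) + ennreal (2 * K\<^sup>2) * ?D z + ennreal \<delta>) \<partial>\<pi>)"
    proof (rule nn_integral_mono_AE)
      show "AE z in \<pi>. (\<integral>\<^sup>+ p. ?D z + ennreal ((dist (fst p) (snd p))\<^sup>2) \<partial>\<gamma> z)
          \<le> ?D z + (2 * v (fst z) + ennreal (2 * K\<^sup>2) * ?D z + ennreal \<delta>)"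
        using AE\<pi> AE_space
      proof eventually_elim
        case (elim z)
        then have z: "z \<in> space (?S \<Otimes>\<^sub>M ?S)" by (simp add: space\<pi>)
        interpret \<gamma>z: prob_space "\<gamma> z" using measurable_space[OF \<gamma> z] by (simp add: space_prob_algebra)
        have [measurable_cong]: "sets (\<gamma> z) = sets (borel \<Otimes>\<^sub>M borel)"
          using measurable_space[OF \<gamma> z] by (simp add: space_prob_algebra)
        have "(\<integral>\<^sup>+ p. ?D z + ennreal ((dist (fst p) (snd p))\<^sup>2) \<partial>\<gamma> z)
            = ?D z + (\<integral>\<^sup>+ p. ennreal ((dist (fst p) (snd p))\<^sup>2) \<partial>\<gamma> z)"
          by (subst nn_integral_add) (auto simp: \<gamma>z.emeasure_space_1)
        then show ?case using cost[OF z elim(1)] by (simp add: add_left_mono)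
      qed
    qed
    also have "\<dots> = (\<integral>\<^sup>+ z. ?D z \<partial>\<pi>) + (2 * (\<integral>\<^sup>+ z. v (fst z) \<partial>\<pi>)
        + ennreal (2 * K\<^sup>2) * (\<integral>\<^sup>+ z. ?D z \<partial>\<pi>) + ennreal \<delta>)"
      by (simp add: nn_integral_add nn_integral_cmult emeasure_space_1)
    also have "(\<integral>\<^sup>+ z. v (fst z) \<partial>\<pi>) = (\<integral>\<^sup>+ a. v a \<partial>P)"
      by (rule nn_integral_couplings(1)[OF \<pi> vP])
    also have "\<dots> \<le> ennreal \<epsilon>" by (rule v_le)
    also have "(\<integral>\<^sup>+ z. ?D z \<partial>\<pi>) + (2 * ennreal \<epsilon> + ennreal (2 * K\<^sup>2) * (\<integral>\<^sup>+ z. ?D z \<partial>\<pi>) + ennreal \<delta>)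
        = ennreal (2 * \<epsilon>) + ennreal (1 + 2 * K\<^sup>2) * (\<integral>\<^sup>+ z. ?D z \<partial>\<pi>) + ennreal \<delta>"
      using \<open>\<epsilon> \<ge> 0\<close> by (simp add: ennreal_mult ennreal_plus distrib_right ac_simps)
    finally show "(wasserstein2 (path_dist (Suc i)) (kernel_prod i P \<kappa>) (kernel_prod i Q \<mu>))\<^sup>2
        \<le> ennreal (2 * \<epsilon>) + ennreal (1 + 2 * K\<^sup>2) * (\<integral>\<^sup>+ z. ?D z \<partial>\<pi>) + ennreal \<delta>"
      by (simp add: add_left_mono add_right_mono mult_left_mono)
  qed
qed (auto simp: add_pos_nonneg)

section \<open>Laws of the two processes\<close>

lemma joint_law_0:
  assumes [measurable]: "X 0 \<in> borel_measurable \<Omega>"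
  shows "joint_law \<Omega> X 0 = distr (distr \<Omega> borel (X 0)) (path_space 0) (\<lambda>x. \<lambda>j\<in>{..0}. x)"
proof -
  have "(\<lambda>x. \<lambda>j\<in>{..0::nat}. x) \<in> borel \<rightarrow>\<^sub>M path_space 0" by (rule measurable_restrict) simp
  then show ?thesis
    unfolding joint_law_def by (subst distr_distr) (auto simp: comp_def restrict_def intro!: distr_cong)
qed

context
  fixes \<Omega> :: "'w measure" and X :: "nat \<Rightarrow> 'w \<Rightarrow> 'a::euclidean_space" and n :: nat
  assumes \<Omega>: "prob_space \<Omega>" and X[measurable]: "\<And>i. i \<le> n \<Longrightarrow> X i \<in> borel_measurable \<Omega>"
begin

lemma measurable_restrict_path: "i \<le> n \<Longrightarrow> (\<lambda>\<omega>. \<lambda>j\<in>{..i}. X j \<omega>) \<in> \<Omega> \<rightarrow>\<^sub>M path_space i"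
  by (rule measurable_restrict) auto

lemma joint_law_in_prob_algebra: "i \<le> n \<Longrightarrow> joint_law \<Omega> X i \<in> space (prob_algebra (path_space i))"
  unfolding joint_law_def
  by (simp add: space_prob_algebra prob_space.prob_space_distr[OF \<Omega> measurable_restrict_path])

lemma joint_law_path_norm:
  assumes "i \<le> n" and fin: "\<And>j. j \<le> i \<Longrightarrow> (\<integral>\<^sup>+ \<omega>. ennreal ((norm (X j \<omega>))\<^sup>2) \<partial>\<Omega>) < \<infinity>"
  shows "(\<integral>\<^sup>+ x. ennreal ((path_norm i x)\<^sup>2) \<partial>joint_law \<Omega> X i) < \<infinity>"
proof -
  have "(\<integral>\<^sup>+ x. ennreal ((path_norm i x)\<^sup>2) \<partial>joint_law \<Omega> X i)
      = (\<integral>\<^sup>+ \<omega>. ennreal ((path_norm i (\<lambda>j\<in>{..i}. X j \<omega>))\<^sup>2) \<partial>\<Omega>)"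
    unfolding joint_law_def by (subst nn_integral_distr[OF measurable_restrict_path[OF assms(1)]]) simp_all
  also have "\<dots> = (\<integral>\<^sup>+ \<omega>. (\<Sum>j\<le>i. ennreal ((norm (X j \<omega>))\<^sup>2)) \<partial>\<Omega>)"
    by (simp add: path_norm_square)
  also have "\<dots> = (\<Sum>j\<le>i. \<integral>\<^sup>+ \<omega>. ennreal ((norm (X j \<omega>))\<^sup>2) \<partial>\<Omega>)"
    using assms(1) by (intro nn_integral_sum) auto
  also have "\<dots> < \<infinity>" using fin by simp
  finally show ?thesis .
qed

text \<open>The second moment of \<open>X\<^sub>i\<^sub>+\<^sub>1\<close> is the mean of the second moments of its conditional laws.\<close>

lemma cond_second_moment:
  assumes i: "Suc i \<le> n" and cond: "regular_cond_dist \<Omega> X i \<kappa>"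
    and fin: "(\<integral>\<^sup>+ \<omega>. ennreal ((norm (X (Suc i) \<omega>))\<^sup>2) \<partial>\<Omega>) < \<infinity>"
  shows "AE a in joint_law \<Omega> X i. second_moment (\<kappa> a) < \<infinity>"
proof -
  have \<kappa>: "path_kernel i \<kappa>" and eq: "joint_law \<Omega> X (Suc i) = kernel_prod i (joint_law \<Omega> X i) \<kappa>"
    using cond by (auto simp: regular_cond_dist_def)
  have sets: "sets (joint_law \<Omega> X i) = sets (path_space i)" by (simp add: joint_law_def)
  have [measurable]: "(\<lambda>x. ennreal ((norm (x (Suc i)))\<^sup>2)) \<in> borel_measurable (path_space (Suc i) :: (nat \<Rightarrow> 'a) measure)"
    by measurable
  have "(\<integral>\<^sup>+ a. second_moment (\<kappa> a) \<partial>joint_law \<Omega> X i) = (\<integral>\<^sup>+ x. ennreal ((norm (x (Suc i)))\<^sup>2) \<partial>joint_law \<Omega> X (Suc i))"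
    unfolding eq by (subst nn_integral_kernel_prod[OF sets \<kappa>]) (simp_all add: second_moment_def)
  also have "\<dots> = (\<integral>\<^sup>+ \<omega>. ennreal ((norm (X (Suc i) \<omega>))\<^sup>2) \<partial>\<Omega>)"
    unfolding joint_law_def by (subst nn_integral_distr[OF measurable_restrict_path[OF i]]) simp_all
  finally have "(\<integral>\<^sup>+ a. second_moment (\<kappa> a) \<partial>joint_law \<Omega> X i) \<noteq> \<infinity>" using fin by simp
  moreover have "(\<lambda>a. second_moment (\<kappa> a)) \<in> borel_measurable (joint_law \<Omega> X i)"
    unfolding second_moment_def measurable_cong_sets[OF sets refl]
    by (rule measurable_compose[OF measurable_prob_algebraD[OF \<kappa>] nn_integral_measurable_subprob_algebra]) measurable
  ultimately have "AE a in joint_law \<Omega> X i. second_moment (\<kappa> a) \<noteq> \<infinity>"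
    by (intro nn_integral_PInf_AE)
  then show ?thesis by (simp add: top.not_eq_extremum)
qed

text \<open>A finite mean distance provides one point where \<open>\<kappa>\<close> has a finite second moment and \<open>\<mu>\<close> is at finite
  distance from it. So \<open>\<mu>\<close> has a finite second moment there, and the Lipschitz condition carries this to
  every other point.\<close>

lemma kernel_second_moment:
  assumes i: "i \<le> n" and \<kappa>: "path_kernel i \<kappa>" and \<mu>: "path_kernel i \<mu>"
    and moment: "AE a in joint_law \<Omega> X i. second_moment (\<kappa> a) < \<infinity>"
    and close: "(\<integral>\<^sup>+ a. (wasserstein2 dist (\<kappa> a) (\<mu> a))\<^sup>2 \<partial>joint_law \<Omega> X i) < \<infinity>"
    and lipschitz: "\<And>a b. a \<in> space (path_space i) \<Longrightarrow> b \<in> space (path_space i) \<Longrightarrow>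
      wasserstein2 dist (\<mu> a) (\<mu> b) < \<infinity>"
    and b: "b \<in> space (path_space i)"
  shows "second_moment (\<mu> b) < \<infinity>"
proof -
  interpret P: prob_space "joint_law \<Omega> X i"
    using joint_law_in_prob_algebra[OF i] by (simp add: space_prob_algebra)
  have space: "space (joint_law \<Omega> X i) = space (path_space i)" by (simp add: joint_law_def)
  have sets: "sets (\<kappa> a) = sets borel" "sets (\<mu> a) = sets borel" if "a \<in> space (path_space i)" for a
    using measurable_space[OF \<kappa> that] measurable_space[OF \<mu> that] by (auto simp: space_prob_algebra)
  have "\<exists>a\<in>space (path_space i). second_moment (\<kappa> a) < \<infinity> \<and> (wasserstein2 dist (\<kappa> a) (\<mu> a))\<^sup>2 < \<infinity>"
  proof (rule ccontr)
    \<comment> \<open>Otherwise the distance is infinite almost everywhere, and so is its integral.\<close>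
    assume none: "\<not> ?thesis"
    have "(\<integral>\<^sup>+ a. (wasserstein2 dist (\<kappa> a) (\<mu> a))\<^sup>2 \<partial>joint_law \<Omega> X i) = (\<integral>\<^sup>+ a. \<infinity> \<partial>joint_law \<Omega> X i)"
    proof (rule nn_integral_cong_AE)
      show "AE a in joint_law \<Omega> X i. (wasserstein2 dist (\<kappa> a) (\<mu> a))\<^sup>2 = \<infinity>"
        using moment AE_space
      proof eventually_elim
        case (elim a)
        with none have "\<not> (wasserstein2 dist (\<kappa> a) (\<mu> a))\<^sup>2 < \<infinity>" by (auto simp: space)
        then show ?case by (simp add: not_less top_unique)
      qed
    qed
    with close show False by (simp add: P.emeasure_space_1)
  qed
  then obtain a where a: "a \<in> space (path_space i)" "second_moment (\<kappa> a) < \<infinity>"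
      "(wasserstein2 dist (\<kappa> a) (\<mu> a))\<^sup>2 < \<infinity>" by blast
  have "second_moment (\<mu> a) \<le> 2 * second_moment (\<kappa> a) + 2 * (wasserstein2 dist (\<kappa> a) (\<mu> a))\<^sup>2"
    using sets[OF a(1)] by (rule second_moment_le_wasserstein2)
  also have "\<dots> < \<infinity>" using a by (simp add: ennreal_mult_less_top)
  finally have "second_moment (\<mu> a) < \<infinity>" .
  moreover have "(wasserstein2 dist (\<mu> a) (\<mu> b))\<^sup>2 < \<infinity>"
    using lipschitz[OF a(1) b] by (simp add: power2_eq_square ennreal_mult_less_top)
  moreover have "second_moment (\<mu> b) \<le> 2 * second_moment (\<mu> a) + 2 * (wasserstein2 dist (\<mu> a) (\<mu> b))\<^sup>2"
    using sets(2)[OF a(1)] sets(2)[OF b] by (rule second_moment_le_wasserstein2)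
  ultimately show ?thesis
    by (elim le_less_trans) (simp add: ennreal_mult_less_top)
qed

end

lemma iterated_prod_in_prob_algebra:
  assumes P: "P \<in> space (prob_algebra borel)" and \<mu>: "\<And>j. j < i \<Longrightarrow> path_kernel j (\<mu> j)"
  shows "iterated_prod P \<mu> i \<in> space (prob_algebra (path_space i))"
  using \<mu>
proof (induction i)
  case 0
  have "(\<lambda>x. \<lambda>j\<in>{..0::nat}. x) \<in> borel \<rightarrow>\<^sub>M path_space 0" by (rule measurable_restrict) simp
  then have "(\<lambda>x. \<lambda>j\<in>{..0::nat}. x) \<in> P \<rightarrow>\<^sub>M path_space 0"
    using P by (simp add: space_prob_algebra cong: measurable_cong_sets)
  then show ?case
    using P by (auto simp: space_prob_algebra intro: prob_space.prob_space_distr)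
next
  case (Suc i)
  then show ?case by (simp add: kernel_prod_in_prob_algebra)
qed

theorem theoremB2:
  fixes \<Omega> :: "'w measure"
    and X :: "nat \<Rightarrow> 'w \<Rightarrow> real ^ 'd::finite"
    and Y\<^sub>0 :: "'w \<Rightarrow> real ^ 'd"
    and \<mu> \<kappa> :: "nat \<Rightarrow> (nat \<Rightarrow> real ^ 'd) \<Rightarrow> (real ^ 'd) measure"
    and n :: nat and \<epsilon> K :: real
  assumes "n \<ge> 1" and "\<epsilon> \<ge> 0" and "K \<ge> 0"
    and "prob_space \<Omega>"
    and X_rv: "\<And>i. i \<le> n \<Longrightarrow> X i \<in> borel_measurable \<Omega>"
    and X_sq: "\<And>i. i \<le> n \<Longrightarrow> integrable \<Omega> (\<lambda>\<omega>. (norm (X i \<omega>))\<^sup>2)"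
    and Y_rv: "Y\<^sub>0 \<in> borel_measurable \<Omega>"
    and Y_sq: "integrable \<Omega> (\<lambda>\<omega>. (norm (Y\<^sub>0 \<omega>))\<^sup>2)"
    and kernel: "\<And>i. i < n \<Longrightarrow> path_kernel i (\<mu> i)"
    and cond: "\<And>i. i < n \<Longrightarrow> regular_cond_dist \<Omega> X i (\<kappa> i)"
    and close: "\<And>i. i < n \<Longrightarrow>
      (\<integral>\<^sup>+ a. (wasserstein2 dist (\<kappa> i a) (\<mu> i a))\<^sup>2 \<partial>joint_law \<Omega> X i) \<le> ennreal \<epsilon>"
    and lipschitz: "\<And>i a b. i < n \<Longrightarrow> a \<in> space (path_space i) \<Longrightarrow> b \<in> space (path_space i) \<Longrightarrow>
      wasserstein2 dist (\<mu> i a) (\<mu> i b) \<le> ennreal (K * path_dist i a b)"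
  shows "iterated_prod (distr \<Omega> borel Y\<^sub>0) \<mu> n \<in> path_P2 n \<and>
    (wasserstein2 (path_dist n) (joint_law \<Omega> X n) (iterated_prod (distr \<Omega> borel Y\<^sub>0) \<mu> n))\<^sup>2
      \<le> ennreal (2 * \<epsilon> * (\<Sum>i<n. (1 + 2 * K\<^sup>2) ^ i))
        + ennreal ((1 + 2 * K\<^sup>2) ^ n)
          * (wasserstein2 dist (distr \<Omega> borel (X 0)) (distr \<Omega> borel Y\<^sub>0))\<^sup>2"
proof
  let ?P = "joint_law \<Omega> X" and ?Q = "iterated_prod (distr \<Omega> borel Y\<^sub>0) \<mu>"
  let ?q = "1 + 2 * K\<^sup>2" and ?W0 = "(wasserstein2 dist (distr \<Omega> borel (X 0)) (distr \<Omega> borel Y\<^sub>0))\<^sup>2"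
  have q: "?q \<ge> 0" by simp
  have X_fin: "(\<integral>\<^sup>+ \<omega>. ennreal ((norm (X i \<omega>))\<^sup>2) \<partial>\<Omega>) < \<infinity>" if "i \<le> n" for i
    using X_sq[OF that] by (simp add: integrable_iff_bounded)
  have Y_fin: "(\<integral>\<^sup>+ \<omega>. ennreal ((norm (Y\<^sub>0 \<omega>))\<^sup>2) \<partial>\<Omega>) < \<infinity>"
    using Y_sq by (simp add: integrable_iff_bounded)
  have law: "?P i \<in> space (prob_algebra (path_space i))" if "i \<le> n" for i
    by (rule joint_law_in_prob_algebra[OF \<open>prob_space \<Omega>\<close> X_rv that])
  have "distr \<Omega> borel Y\<^sub>0 \<in> space (prob_algebra borel)"
    using prob_space.prob_space_distr[OF \<open>prob_space \<Omega>\<close> Y_rv] by (simp add: space_prob_algebra)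
  then have approx: "?Q i \<in> space (prob_algebra (path_space i))" if "i \<le> n" for i
    using that kernel by (intro iterated_prod_in_prob_algebra) auto
  have bound: "(wasserstein2 (path_dist i) (?P i) (?Q i))\<^sup>2
      \<le> ennreal (2 * \<epsilon> * (\<Sum>j<i. ?q ^ j)) + ennreal (?q ^ i) * ?W0" if "i \<le> n" for i
    using that
  proof (induction i)
    case 0
    have "(\<lambda>x. \<lambda>j\<in>{..0::nat}. x) \<in> borel \<rightarrow>\<^sub>M (path_space 0 :: (nat \<Rightarrow> real ^ 'd) measure)"
      by (rule measurable_restrict) simp
    then have "(wasserstein2 (path_dist 0) (?P 0) (?Q 0))\<^sup>2 \<le> ?W0"
      unfolding joint_law_0[of X, OF X_rv[OF le0]] iterated_prod.simps
      by (intro wasserstein2_distr_le) (simp_all add: path_dist_square)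
    then show ?case by simp
  next
    case (Suc i)
    then have i: "i < n" "Suc i \<le> n" "i \<le> n" by auto
    have \<kappa>: "path_kernel i (\<kappa> i)" and law_Suc: "?P (Suc i) = kernel_prod i (?P i) (\<kappa> i)"
      using cond[OF i(1)] by (auto simp: regular_cond_dist_def)
    have \<kappa>_moment: "AE a in ?P i. second_moment (\<kappa> i a) < \<infinity>"
      by (rule cond_second_moment[OF \<open>prob_space \<Omega>\<close> X_rv i(2) cond[OF i(1)] X_fin[OF i(2)]])
    have \<mu>_moment: "second_moment (\<mu> i b) < \<infinity>" if "b \<in> space (path_space i)" for b
    proof (rule kernel_second_moment[OF \<open>prob_space \<Omega>\<close> X_rv i(3) \<kappa> kernel[OF i(1)] \<kappa>_moment _ _ that])
      show "(\<integral>\<^sup>+ a. (wasserstein2 dist (\<kappa> i a) (\<mu> i a))\<^sup>2 \<partial>?P i) < \<infinity>"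
        using close[OF i(1)] by (rule le_less_trans) simp
      show "wasserstein2 dist (\<mu> i a) (\<mu> i b) < \<infinity>"
        if "a \<in> space (path_space i)" "b \<in> space (path_space i)" for a b
        using lipschitz[OF i(1) that] by (rule le_less_trans) simp
    qed
    have "(wasserstein2 (path_dist (Suc i)) (?P (Suc i)) (?Q (Suc i)))\<^sup>2
        \<le> ennreal (2 * \<epsilon>) + ennreal ?q * (wasserstein2 (path_dist i) (?P i) (?Q i))\<^sup>2"
      unfolding law_Suc iterated_prod.simps
      by (rule wasserstein2_kernel_prod_le[OF law[OF i(3)] approx[OF i(3)] \<kappa> kernel[OF i(1)]
            \<kappa>_moment \<mu>_moment close[OF i(1)] lipschitz[OF i(1)] \<open>\<epsilon> \<ge> 0\<close> \<open>K \<ge> 0\<close>])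
    also have "\<dots> \<le> ennreal (2 * \<epsilon>) + ennreal ?q * (ennreal (2 * \<epsilon> * (\<Sum>j<i. ?q ^ j)) + ennreal (?q ^ i) * ?W0)"
      using Suc.IH[OF i(3)] by (intro add_left_mono mult_left_mono) auto
    also have "\<dots> = ennreal (2 * \<epsilon>) + ennreal (?q * (2 * \<epsilon> * (\<Sum>j<i. ?q ^ j))) + ennreal (?q ^ Suc i) * ?W0"
      using q \<open>\<epsilon> \<ge> 0\<close> by (simp add: distrib_left ennreal_mult sum_nonneg mult.assoc add.assoc del: ennreal_plus)
    also have "ennreal (2 * \<epsilon>) + ennreal (?q * (2 * \<epsilon> * (\<Sum>j<i. ?q ^ j))) = ennreal (2 * \<epsilon> + ?q * (2 * \<epsilon> * (\<Sum>j<i. ?q ^ j)))"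
      using q \<open>\<epsilon> \<ge> 0\<close> by (intro ennreal_plus[symmetric] mult_nonneg_nonneg sum_nonneg zero_le_power) auto
    also have "2 * \<epsilon> + ?q * (2 * \<epsilon> * (\<Sum>j<i. ?q ^ j)) = 2 * \<epsilon> * (\<Sum>j<Suc i. ?q ^ j)"
      by (simp only: sum.lessThan_Suc_shift power_0 power_Suc sum_distrib_left[symmetric] distrib_left) simp
    finally show ?case .
  qed
  then show "(wasserstein2 (path_dist n) (?P n) (?Q n))\<^sup>2
      \<le> ennreal (2 * \<epsilon> * (\<Sum>i<n. ?q ^ i)) + ennreal (?q ^ n) * ?W0" by blast
  have "(\<integral>\<^sup>+ x. ennreal ((path_norm n x)\<^sup>2) \<partial>?Q n)
      \<le> 2 * (\<integral>\<^sup>+ x. ennreal ((path_norm n x)\<^sup>2) \<partial>?P n) + 2 * (wasserstein2 (path_dist n) (?P n) (?Q n))\<^sup>2"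
  proof (rule moment_le_wasserstein2)
    have sets: "sets (?P n) = sets (path_space n)" "sets (?Q n) = sets (path_space n)"
      using law[of n] approx[of n] by (auto simp: space_prob_algebra)
    show "(\<lambda>x. ennreal ((path_norm n x)\<^sup>2)) \<in> borel_measurable (?P n)"
      "(\<lambda>x. ennreal ((path_norm n x)\<^sup>2)) \<in> borel_measurable (?Q n)"
      "(\<lambda>z. ennreal ((path_dist n (fst z) (snd z))\<^sup>2)) \<in> borel_measurable (?P n \<Otimes>\<^sub>M ?Q n)"
      by (simp_all add: sets cong: measurable_cong_sets sets_pair_measure_cong)
  qed (rule path_norm_square_le)
  also have "\<dots> < \<infinity>"
  proof -
    have "?W0 < \<infinity>" using X_fin[of 0] Y_fin X_rv[of 0] Y_rv by (intro wasserstein2_square_integrable) auto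
    then have "ennreal (2 * \<epsilon> * (\<Sum>i<n. ?q ^ i)) + ennreal (?q ^ n) * ?W0 < \<infinity>"
      by (simp add: ennreal_mult_less_top)
    with bound[of n] have "(wasserstein2 (path_dist n) (?P n) (?Q n))\<^sup>2 < \<infinity>" by (auto elim: le_less_trans)
    moreover have "(\<integral>\<^sup>+ x. ennreal ((path_norm n x)\<^sup>2) \<partial>?P n) < \<infinity>"
      by (rule joint_law_path_norm[OF \<open>prob_space \<Omega>\<close> X_rv _ X_fin]) auto
    ultimately show ?thesis by (simp add: ennreal_mult_less_top)
  qed
  finally show "?Q n \<in> path_P2 n"
    using approx[of n] by (simp add: path_P2_def space_prob_algebra)
qed

end
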